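(* Let $z>0$ and $(a,b,c)\in V$. For every $\alpha\in\mathbb T$, the densely defined operator $(L,\mathcal D_\alpha)$ on $\mathcal H$ is self-adjoint, i.e. $\mathcal D_\alpha=\mathcal D_\alpha^*$, where $\mathcal D_\alpha^*$ is the domain of the adjoint of $(L,\mathcal D_\alpha)$.
   Context: Fix $0<q<1$ and $z>0$. Notation: $(x;q)_\infty=\prod_{i\ge 0}(1-xq^i)$, $(x_1,\dots,x_r;q)_\infty=\prod_j(x_j;q)_\infty$; $\mathbb T=\{\alpha\in\mathbb C:|\alpha|=1\}$. $V=\{(a,b,c): a,b,c>0,\ ab,ac,bc<1\}$. $I=\{-q^k: k=0,1,2,\dots\}\cup\{zq^k: k\in\mathbb Z\}$. For $f:I\to\mathbb C$ and $x\in I\setminus\{-1\}$, $(Lf)(x)=A(x)(f(qx)-f(x))+B(x)(f(q^{-1}x)-f(x))$, with $A(x)=a^2\left(1+\frac1{abx}\right)\left(1+\frac1{acx}\right)$ and $B(x)=\left(1+\frac{q}{bcx}\right)\left(1+\frac1x\right)$; $(Lf)(-1)=A(-1)(f(-q)-f(-1))$. $p(x)=\frac{(-abx,-acx;q)_\infty}{(-bcx,-qx;q)_\infty}$, which is $>0$ on $I$. $\mathcal H$ is the Hilbert space of $f:I\to\mathbb C$ with $\langle f,f\rangle<\infty$, where $$\langle f,g\rangle=\sum_{k\ge0}f(-q^k)\overline{g(-q^k)}\frac{(1-q)q^k}{p(-q^k)}+\sum_{k\in\mathbb Z}f(zq^k)\overline{g(zq^k)}\frac{(1-q)zq^k}{p(zq^k)}.$$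 $(D_qf)(x)=\frac{f(x)-f(qx)}{(1-q)x}$; $f(0^+)=\lim_{k\to\infty}f(zq^k)$, $f(0^-)=\lim_{k\to\infty}f(-q^k)$, $f'(0^+)=\lim_{k\to\infty}(D_qf)(zq^k)$, $f'(0^-)=\lim_{k\to\infty}(D_qf)(-q^k)$, when the limits exist. $\mathcal D_\alpha$ is the (dense) subspace of those $f\in\mathcal H$ with $Lf\in\mathcal H$ for which these four limits exist and $f(0^+)=\alpha f(0^-)$, $f'(0^+)=\alpha f'(0^-)$. *)

theory Defs
  imports "HOL-Analysis.Analysis"
begin

section \<open>Unbounded operators on a space of complex-valued functions\<close>

text \<open>
  The Hilbert space is given by a carrier \<open>H\<close> of functions and an inner product \<open>ip\<close>
  (linear in the first argument, conjugate linear in the second); an operator is a map \<open>T\<close>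
  considered only on its domain \<open>D\<close>.
\<close>

definition hnorm :: "(('a \<Rightarrow> complex) \<Rightarrow> ('a \<Rightarrow> complex) \<Rightarrow> complex) \<Rightarrow> ('a \<Rightarrow> complex) \<Rightarrow> real" where
  "hnorm ip f = sqrt (Re (ip f f))"

definition linear_subspace :: "('a \<Rightarrow> complex) set \<Rightarrow> bool" where
  "linear_subspace D \<longleftrightarrow>
     (\<lambda>x. 0) \<in> D \<and>
     (\<forall>f\<in>D. \<forall>g\<in>D. (\<lambda>x. f x + g x) \<in> D) \<and>
     (\<forall>s. \<forall>f\<in>D. (\<lambda>x. s * f x) \<in> D)"

definition linear_operator_on ::
  "('a \<Rightarrow> complex) set \<Rightarrow> (('a \<Rightarrow> complex) \<Rightarrow> ('a \<Rightarrow> complex)) \<Rightarrow> ('a \<Rightarrow> complex) set \<Rightarrow> bool" where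
  "linear_operator_on H T D \<longleftrightarrow>
     D \<subseteq> H \<and> linear_subspace D \<and> T ` D \<subseteq> H \<and>
     (\<forall>f\<in>D. \<forall>g\<in>D. T (\<lambda>x. f x + g x) = (\<lambda>x. T f x + T g x)) \<and>
     (\<forall>s. \<forall>f\<in>D. T (\<lambda>x. s * f x) = (\<lambda>x. s * T f x))"

definition dense_in ::
  "('a \<Rightarrow> complex) set \<Rightarrow> (('a \<Rightarrow> complex) \<Rightarrow> ('a \<Rightarrow> complex) \<Rightarrow> complex) \<Rightarrow>
   ('a \<Rightarrow> complex) set \<Rightarrow> bool" where
  "dense_in H ip D \<longleftrightarrow>
     D \<subseteq> H \<and> (\<forall>f\<in>H. \<forall>e>0. \<exists>g\<in>D. hnorm ip (\<lambda>x. f x - g x) < e)"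

definition adjoint_domain ::
  "('a \<Rightarrow> complex) set \<Rightarrow> (('a \<Rightarrow> complex) \<Rightarrow> ('a \<Rightarrow> complex) \<Rightarrow> complex) \<Rightarrow>
   (('a \<Rightarrow> complex) \<Rightarrow> ('a \<Rightarrow> complex)) \<Rightarrow> ('a \<Rightarrow> complex) set \<Rightarrow> ('a \<Rightarrow> complex) set" where
  "adjoint_domain H ip T D = {g \<in> H. \<exists>h\<in>H. \<forall>f\<in>D. ip (T f) g = ip f h}"

text \<open>The value is determined uniquely when \<open>D\<close> is dense and \<open>g\<close> is in the adjoint domain.\<close>

definition adjoint_op ::
  "('a \<Rightarrow> complex) set \<Rightarrow> (('a \<Rightarrow> complex) \<Rightarrow> ('a \<Rightarrow> complex) \<Rightarrow> complex) \<Rightarrow>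
   (('a \<Rightarrow> complex) \<Rightarrow> ('a \<Rightarrow> complex)) \<Rightarrow> ('a \<Rightarrow> complex) set \<Rightarrow>
   ('a \<Rightarrow> complex) \<Rightarrow> ('a \<Rightarrow> complex)" where
  "adjoint_op H ip T D g = (THE h. h \<in> H \<and> (\<forall>f\<in>D. ip (T f) g = ip f h))"

definition self_adjoint ::
  "('a \<Rightarrow> complex) set \<Rightarrow> (('a \<Rightarrow> complex) \<Rightarrow> ('a \<Rightarrow> complex) \<Rightarrow> complex) \<Rightarrow>
   (('a \<Rightarrow> complex) \<Rightarrow> ('a \<Rightarrow> complex)) \<Rightarrow> ('a \<Rightarrow> complex) set \<Rightarrow> bool" where
  "self_adjoint H ip T D \<longleftrightarrow>
     linear_operator_on H T D \<and> dense_in H ip D \<and>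
     D = adjoint_domain H ip T D \<and> (\<forall>g\<in>D. adjoint_op H ip T D g = T g)"

section \<open>The second order q-difference operator\<close>

definition V :: "(real \<times> real \<times> real) set" where
  "V = {(a, b, c). a > 0 \<and> b > 0 \<and> c > 0 \<and> a * b < 1 \<and> a * c < 1 \<and> b * c < 1}"

definition qpoch :: "real \<Rightarrow> real \<Rightarrow> real" where
  "qpoch q x = (\<Prod>i. 1 - x * q ^ i)"

definition I :: "real \<Rightarrow> real \<Rightarrow> real set" where
  "I q z = range (\<lambda>k::nat. - (q ^ k)) \<union> range (\<lambda>k::int. z * q powi k)"

definition p :: "real \<Rightarrow> real \<Rightarrow> real \<Rightarrow> real \<Rightarrow> real \<Rightarrow> real" where
  "p q a b c x = (qpoch q (- a * b * x) * qpoch q (- a * c * x)) /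
                 (qpoch q (- b * c * x) * qpoch q (- q * x))"

definition coeffA :: "real \<Rightarrow> real \<Rightarrow> real \<Rightarrow> real \<Rightarrow> real" where
  "coeffA a b c x = a\<^sup>2 * (1 + 1 / (a * b * x)) * (1 + 1 / (a * c * x))"

definition coeffB :: "real \<Rightarrow> real \<Rightarrow> real \<Rightarrow> real \<Rightarrow> real" where
  "coeffB q b c x = (1 + q / (b * c * x)) * (1 + 1 / x)"

text \<open>
  A function from \<open>I q z\<close> to the complex numbers is represented by its extension by zero to the
  whole real line, so that equality of representatives is equality on \<open>I q z\<close>; accordingly
  \<open>L\<close> returns a function that vanishes off \<open>I q z\<close>.
\<close>

definition L ::
  "real \<Rightarrow> real \<Rightarrow> real \<Rightarrow> real \<Rightarrow> real \<Rightarrow> (real \<Rightarrow> complex) \<Rightarrow> (real \<Rightarrow> complex)" where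
  "L q z a b c f x =
     (if x \<notin> I q z then 0
      else if x = -1 then of_real (coeffA a b c (-1)) * (f (- q) - f (-1))
      else of_real (coeffA a b c x) * (f (q * x) - f x)
         + of_real (coeffB q b c x) * (f (inverse q * x) - f x))"

definition weight_neg :: "real \<Rightarrow> real \<Rightarrow> real \<Rightarrow> real \<Rightarrow> nat \<Rightarrow> real" where
  "weight_neg q a b c k = (1 - q) * q ^ k / p q a b c (- (q ^ k))"

definition weight_pos :: "real \<Rightarrow> real \<Rightarrow> real \<Rightarrow> real \<Rightarrow> real \<Rightarrow> int \<Rightarrow> real" where
  "weight_pos q z a b c k = (1 - q) * (z * q powi k) / p q a b c (z * q powi k)"

definition inner_H ::
  "real \<Rightarrow> real \<Rightarrow> real \<Rightarrow> real \<Rightarrow> real \<Rightarrow> (real \<Rightarrow> complex) \<Rightarrow> (real \<Rightarrow> complex) \<Rightarrow> complex" where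
  "inner_H q z a b c f g =
     (\<Sum>\<^sub>\<infinity>k::nat. f (- (q ^ k)) * cnj (g (- (q ^ k))) * of_real (weight_neg q a b c k)) +
     (\<Sum>\<^sub>\<infinity>k::int. f (z * q powi k) * cnj (g (z * q powi k)) * of_real (weight_pos q z a b c k))"

text \<open>
  The two summability conditions say that the inner product of \<open>f\<close> with itself is finite: its
  terms are nonnegative, because \<open>p\<close> is positive on \<open>I q z\<close>.
\<close>

definition H :: "real \<Rightarrow> real \<Rightarrow> real \<Rightarrow> real \<Rightarrow> real \<Rightarrow> (real \<Rightarrow> complex) set" where
  "H q z a b c =
     {f. (\<forall>x. x \<notin> I q z \<longrightarrow> f x = 0) \<and>
         (\<lambda>k::nat. (cmod (f (- (q ^ k))))\<^sup>2 * weight_neg q a b c k) summable_on UNIV \<and>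
         (\<lambda>k::int. (cmod (f (z * q powi k)))\<^sup>2 * weight_pos q z a b c k) summable_on UNIV}"

definition Dq :: "real \<Rightarrow> (real \<Rightarrow> complex) \<Rightarrow> real \<Rightarrow> complex" where
  "Dq q f x = (f x - f (q * x)) / of_real ((1 - q) * x)"

definition D :: "real \<Rightarrow> real \<Rightarrow> real \<Rightarrow> real \<Rightarrow> real \<Rightarrow> complex \<Rightarrow> (real \<Rightarrow> complex) set" where
  "D q z a b c \<alpha> =
     {f \<in> H q z a b c. L q z a b c f \<in> H q z a b c \<and>
        (\<exists>fpos fneg dpos dneg.
           (\<lambda>k::nat. f (z * q ^ k)) \<longlonglongrightarrow> fpos \<and>
           (\<lambda>k::nat. f (- (q ^ k))) \<longlonglongrightarrow> fneg \<and>
           (\<lambda>k::nat. Dq q f (z * q ^ k)) \<longlonglongrightarrow> dpos \<and>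
           (\<lambda>k::nat. Dq q f (- (q ^ k))) \<longlonglongrightarrow> dneg \<and>
           fpos = \<alpha> * fneg \<and> dpos = \<alpha> * dneg)}"

end

theory Submission
  imports Defs
begin

text \<open>
  Write \<open>w x = (1 - q) \<bar>x\<bar> / p x\<close> for the weight of the inner product and \<open>u = A w\<close>. The identity
  \<open>B(q x) w(q x) = u x\<close> (lemma \<open>B_w_mult_q\<close>) brings the operator into the Sturm--Liouville form
  \<open>w x (L f) x = u x (f(q x) - f x) - u(x/q) (f x - f(x/q))\<close>. Summation by parts turns
  \<open>\<langle>L f, g\<rangle> - \<langle>f, L g\<rangle>\<close> into the boundary values of the bracket
  \<open>u x (f(q x) cnj (g x) - f x cnj (g(q x)))\<close> at the ends of the lattice (lemma \<open>green\<close>).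

  At \<open>-1\<close> there is no boundary term, because \<open>B(-1) = 0\<close>. At infinity the bracket of two elements of
  the Hilbert space tends to 0, because there \<open>u x\<close> is bounded by a multiple of \<open>w x\<close> and of \<open>w(q x)\<close>
  (lemma \<open>bracket_infinity\<close>). The origin is regular from both sides: \<open>w\<close> is summable near it, so
  if \<open>f\<close> and \<open>L f\<close> lie in the Hilbert space, then \<open>u x (f(q x) - f x)\<close> converges, and with it \<open>D\<^sub>q f\<close>
  and \<open>f\<close> (lemma \<open>boundary_values_exist\<close>). Since \<open>(1 - q) \<bar>x\<bar> u x\<close> tends to a constant \<open>\<kappa> > 0\<close>, the
  boundary term is
  \<open>\<kappa> [f(0+) cnj (g'(0+)) - f'(0+) cnj (g(0+))] - \<kappa> [f(0-) cnj (g'(0-)) - f'(0-) cnj (g(0-))]\<close>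
  (lemma \<open>inner_green\<close>). For \<open>\<bar>\<alpha>\<bar> = 1\<close> it vanishes on the domain, so the operator is symmetric.

  Conversely, let \<open>g\<close> be in the domain of the adjoint, with value \<open>h\<close>. Testing against point masses
  gives \<open>h = L g\<close> (lemma \<open>adjoint_value\<close>), so \<open>g\<close> has boundary values at the origin. Testing against
  functions of the domain that are constant, respectively linear, near the origin on either side
  then yields the two boundary conditions for \<open>g\<close>.
\<close>

section \<open>The q-shifted factorial\<close>

lemma convergent_prod_qpoch:
  fixes q x :: real
  assumes "0 < q" "q < 1"
  shows "convergent_prod (\<lambda>i. 1 - x * q ^ i)"
proof -
  have "summable (\<lambda>i. \<bar>x\<bar> * q ^ i)"
    using assms by (intro summable_mult summable_geometric) auto
  then have "summable (\<lambda>i. norm ((1 - x * q ^ i) - 1))"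
    using assms by (simp add: abs_mult)
  then show ?thesis
    using abs_convergent_prod_conv_summable abs_convergent_prod_imp_convergent_prod by blast
qed

lemma qpoch_LIMSEQ:
  assumes "0 < q" "q < 1"
  shows "(\<lambda>n. \<Prod>i<n. 1 - x * q ^ i) \<longlonglongrightarrow> qpoch q x"
  using convergent_prod_LIMSEQ[OF convergent_prod_qpoch[OF assms]]
  unfolding qpoch_def by (simp add: LIMSEQ_lessThan_iff_atMost)

lemma qpoch_factor_pos:
  fixes q x :: real
  assumes "0 < q" "q < 1" "x < 1"
  shows "1 - x * q ^ i > 0"
proof (cases "x \<le> 0")
  case True
  then have "x * q ^ i \<le> 0" using assms by (simp add: mult_nonpos_nonneg)
  then show ?thesis by simp
next
  case False
  have "q ^ i \<le> 1" using assms by (simp add: power_le_one)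
  then have "x * q ^ i \<le> x" using False by (simp add: mult_left_le)
  then show ?thesis using assms by simp
qed

lemma qpoch_pos:
  assumes "0 < q" "q < 1" "x < 1"
  shows "qpoch q x > 0"
proof -
  have "1 - x * q ^ i \<noteq> 0" for i
    using qpoch_factor_pos[OF assms, of i] by simp
  then have "qpoch q x \<noteq> 0"
    unfolding qpoch_def by (intro prodinf_nonzero convergent_prod_qpoch assms)
  moreover have "qpoch q x \<ge> 0"
    by (rule LIMSEQ_le_const[OF qpoch_LIMSEQ[OF assms(1,2)]])
       (auto intro!: prod_nonneg less_imp_le[OF qpoch_factor_pos[OF assms]])
  ultimately show ?thesis by simp
qed

lemma qpoch_split:
  assumes "0 < q" "q < 1"
  shows "qpoch q x = (\<Prod>i<k. 1 - x * q ^ i) * qpoch q (x * q ^ k)"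
proof (rule LIMSEQ_unique)
  show "(\<lambda>n. \<Prod>i<n + k. 1 - x * q ^ i) \<longlonglongrightarrow> qpoch q x"
    using qpoch_LIMSEQ[OF assms] by (rule LIMSEQ_ignore_initial_segment)
  have "(\<Prod>i<n + k. 1 - x * q ^ i) = (\<Prod>i<k. 1 - x * q ^ i) * (\<Prod>i<n. 1 - x * q ^ k * q ^ i)" for n
    by (induction n) (auto simp: power_add mult_ac)
  then show "(\<lambda>n. \<Prod>i<n + k. 1 - x * q ^ i) \<longlonglongrightarrow> (\<Prod>i<k. 1 - x * q ^ i) * qpoch q (x * q ^ k)"
    using tendsto_mult_left[OF qpoch_LIMSEQ[OF assms]] by simp
qed

lemma qpoch_step:
  assumes "0 < q" "q < 1"
  shows "qpoch q x = (1 - x) * qpoch q (q * x)"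
  using qpoch_split[OF assms, of x 1] by (simp add: mult.commute)

lemma qpoch_tendsto_1:
  assumes "0 < q" "q < 1" "x < 1"
  shows "(\<lambda>k. qpoch q (x * q ^ k)) \<longlonglongrightarrow> 1"
proof -
  have nz: "(\<Prod>i<k. 1 - x * q ^ i) \<noteq> 0" for k
    using qpoch_factor_pos[OF assms] by (metis prod_pos less_irrefl)
  have "qpoch q (x * q ^ k) = qpoch q x / (\<Prod>i<k. 1 - x * q ^ i)" for k
    using qpoch_split[OF assms(1,2), of x k] nz[of k] by (simp add: field_simps)
  moreover have "(\<lambda>k. qpoch q x / (\<Prod>i<k. 1 - x * q ^ i)) \<longlonglongrightarrow> qpoch q x / qpoch q x"
    using qpoch_pos[OF assms] by (intro tendsto_intros qpoch_LIMSEQ assms) auto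
  ultimately show ?thesis using qpoch_pos[OF assms] by simp
qed

section \<open>The lattice, the weight and the coefficients\<close>

text \<open>The standing assumptions; the last six are membership of \<open>(a, b, c)\<close> in \<open>V\<close>.\<close>

locale q_lattice =
  fixes q z a b c :: real
  assumes q: "0 < q" "q < 1" and z: "0 < z"
    and abc: "0 < a" "0 < b" "0 < c" "a * b < 1" "a * c < 1" "b * c < 1"
begin

abbreviation "Iq \<equiv> I q z"
abbreviation "Hq \<equiv> H q z a b c"
abbreviation "Lq \<equiv> L q z a b c"
abbreviation "A \<equiv> coeffA a b c"
abbreviation "B \<equiv> coeffB q b c"

text \<open>The weight of the point \<open>x\<close> in the inner product, for both halves of the lattice.\<close>

definition w :: "real \<Rightarrow> real" where
  "w x = (1 - q) * \<bar>x\<bar> / p q a b c x"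

text \<open>The leading coefficient of the operator in Sturm--Liouville form.\<close>

definition u :: "real \<Rightarrow> real" where
  "u x = A x * w x"

lemma I_cases:
  assumes "x \<in> Iq"
  obtains (neg) k :: nat where "x = - (q ^ k)" | (pos) k :: int where "x = z * q powi k"
  using assms by (auto simp: I_def)

lemma neg_in_I [simp, intro]: "- (q ^ k) \<in> Iq" by (auto simp: I_def)
lemma pos_in_I [simp, intro]: "z * q powi k \<in> Iq" by (auto simp: I_def)
lemma minus_one_in_I [simp, intro]: "-1 \<in> Iq" using neg_in_I[of 0] by simp
lemma z_in_I [simp, intro]: "z \<in> Iq" using pos_in_I[of 0] by simp

lemma I_bound: "x \<in> Iq \<Longrightarrow> -1 \<le> x \<and> x \<noteq> 0"
proof (erule I_cases)
  fix k assume "x = - (q ^ k)"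
  then show "-1 \<le> x \<and> x \<noteq> 0" using q by (simp add: power_le_one)
next
  fix k assume "x = z * q powi k"
  moreover have "z * q powi k > 0" using z q by simp
  ultimately show "-1 \<le> x \<and> x \<noteq> 0" by linarith
qed

lemma I_mult_q: "x \<in> Iq \<Longrightarrow> q * x \<in> Iq"
proof (erule I_cases)
  fix k assume "x = - (q ^ k)"
  then show ?thesis using neg_in_I[of "Suc k"] by simp
next
  fix k assume "x = z * q powi k"
  then show ?thesis using pos_in_I[of "k + 1"] q by (simp add: power_int_add mult_ac)
qed

lemma I_mult_power: "x \<in> Iq \<Longrightarrow> x * q ^ k \<in> Iq"
proof (induction k)
  case (Suc k)
  then show ?case using I_mult_q[of "x * q ^ k"] by (simp add: mult_ac)
qed auto

lemma I_div_q: "x \<in> Iq \<Longrightarrow> x \<noteq> -1 \<Longrightarrow> x / q \<in> Iq"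
proof (erule I_cases)
  fix k assume "x \<noteq> -1" and x: "x = - (q ^ k)"
  then obtain j where "k = Suc j" by (cases k) auto
  then show ?thesis using x q by simp
next
  fix k assume "x = z * q powi k"
  then show ?thesis using pos_in_I[of "k - 1"] q by (simp add: power_int_diff)
qed

lemma factor_pos:
  assumes "x \<in> Iq" "0 < t" "t < 1" shows "1 + t * x > 0"
proof -
  have "t * x \<ge> t * (-1)" using I_bound[OF assms(1)] assms by (intro mult_left_mono) auto
  then show ?thesis using assms by simp
qed

lemma factors_pos:
  assumes "x \<in> Iq"
  shows "1 + a * b * x > 0" "1 + a * c * x > 0" "1 + b * c * x > 0" "1 + q * x > 0"
  using factor_pos[OF assms] abc q by auto

lemma p_pos: "x \<in> Iq \<Longrightarrow> p q a b c x > 0"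
  unfolding p_def using factors_pos[of x] q by (intro divide_pos_pos mult_pos_pos qpoch_pos) auto

lemma w_pos: "x \<in> Iq \<Longrightarrow> w x > 0"
  unfolding w_def using p_pos[of x] I_bound[of x] q by simp

lemma w_nonneg: "x \<in> Iq \<Longrightarrow> w x \<ge> 0"
  using w_pos less_imp_le by blast

lemma A_eq: "x \<noteq> 0 \<Longrightarrow> A x = (1 + a * b * x) * (1 + a * c * x) / (b * c * x\<^sup>2)"
  unfolding coeffA_def using abc by (simp add: field_simps power2_eq_square)

lemma B_eq: "x \<noteq> 0 \<Longrightarrow> B x = (q + b * c * x) * (1 + x) / (b * c * x\<^sup>2)"
  unfolding coeffB_def using abc by (simp add: field_simps power2_eq_square)

lemma u_pos: "x \<in> Iq \<Longrightarrow> u x > 0"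
  unfolding u_def using w_pos[of x] factors_pos[of x] I_bound[of x] abc by (simp add: A_eq)

text \<open>Detailed balance: the matrix of the operator is symmetric with respect to the weight.\<close>

lemma B_w_mult_q:
  assumes "x \<in> Iq" shows "B (q * x) * w (q * x) = u x"
proof -
  have x: "x \<noteq> 0" "q * x \<in> Iq" using I_bound assms I_mult_q by auto
  define n1 n2 d1 d2 where "n1 = qpoch q (- a * b * (q * x))" and "n2 = qpoch q (- a * c * (q * x))"
    and "d1 = qpoch q (- b * c * (q * x))" and "d2 = qpoch q (- q * (q * x))"
  have pos: "n1 > 0" "n2 > 0" "d1 > 0" "d2 > 0"
    using factors_pos[OF x(2)] unfolding n1_def n2_def d1_def d2_def
    by (auto intro!: qpoch_pos q)
  have p1: "p q a b c (q * x) = n1 * n2 / (d1 * d2)"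
    unfolding p_def n1_def n2_def d1_def d2_def by simp
  have st: "qpoch q (- t * x) = (1 + t * x) * qpoch q (- t * (q * x))" for t
    using qpoch_step[OF q, of "- t * x"] by (simp add: mult_ac)
  have p2: "p q a b c x = (1 + a * b * x) * n1 * ((1 + a * c * x) * n2) /
     ((1 + b * c * x) * d1 * ((1 + q * x) * d2))"
    using st[of "a * b"] st[of "a * c"] st[of "b * c"] st[of q]
    unfolding p_def n1_def n2_def d1_def d2_def by simp
  show ?thesis
    unfolding u_def w_def p1 p2 A_eq[OF x(1)] using x(1) q pos abc factors_pos[OF assms]
    by (simp add: B_eq abs_mult divide_simps) (simp add: algebra_simps power2_eq_square)
qed

text \<open>
  The point \<open>-1/q\<close> is not in the lattice. The denominator of \<open>p\<close> vanishes there, so \<open>p\<close> and then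
  \<open>w\<close> take the value 0 by the convention \<open>x / 0 = 0\<close>. Together with \<open>B(-1) = 0\<close> this lets the end point
  \<open>-1\<close> be treated like any other lattice point.
\<close>

lemma u_left_of_minus_one: "u (- 1 / q) = 0"
  using qpoch_step[OF q, of 1] q by (simp add: u_def w_def p_def)

lemma B_w:
  assumes "x \<in> Iq" shows "B x * w x = u (x / q)"
proof (cases "x = -1")
  case True
  then show ?thesis using u_left_of_minus_one by (simp add: coeffB_def)
next
  case False
  then show ?thesis using B_w_mult_q[OF I_div_q[OF assms False]] q by simp
qed

lemma L_eq:
  assumes "x \<in> Iq"
  shows "Lq f x = of_real (A x) * (f (q * x) - f x) + of_real (B x) * (f (x / q) - f x)"
  using assms unfolding L_def by (auto simp: coeffB_def field_simps)

lemma L_off_I: "x \<notin> Iq \<Longrightarrow> Lq f x = 0"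
  by (simp add: L_def)

subsection \<open>Asymptotics at the origin\<close>

lemma power_tendsto_0: "(\<lambda>k. s * q ^ k) \<longlonglongrightarrow> 0"
  using q by (intro tendsto_mult_right_zero LIMSEQ_power_zero) auto

lemma p_tendsto_1:
  assumes "s \<in> Iq" shows "(\<lambda>k. p q a b c (s * q ^ k)) \<longlonglongrightarrow> 1"
proof -
  have *: "(\<lambda>k. qpoch q (- t * (s * q ^ k))) \<longlonglongrightarrow> 1" if "1 + t * s > 0" for t
    using qpoch_tendsto_1[OF q, of "- t * s"] that by (simp add: mult_ac)
  have "(\<lambda>k. p q a b c (s * q ^ k)) \<longlonglongrightarrow> 1 * 1 / (1 * 1)"
    unfolding p_def using factors_pos[OF assms] *[of "a * b"] *[of "a * c"] *[of "b * c"] *[of q]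
    by (intro tendsto_intros) auto
  then show ?thesis by simp
qed

text \<open>The limit of \<open>(1 - q) \<bar>x\<bar> u x\<close> at the origin along both halves of the lattice.\<close>

definition kappa :: real where "kappa = (1 - q)\<^sup>2 / (b * c)"

lemma kappa_pos: "kappa > 0"
  using q abc by (simp add: kappa_def)

lemma u_tendsto:
  assumes "s \<in> Iq"
  shows "(\<lambda>k. (1 - q) * (s * q ^ k) * u (s * q ^ k)) \<longlonglongrightarrow> sgn s * kappa"
proof -
  have eq: "(1 - q) * x * u x = sgn x * (1 - q)\<^sup>2 * (1 + a * b * x) * (1 + a * c * x) / (b * c * p q a b c x)"
    if "x \<in> Iq" for x
    using I_bound[OF that] p_pos[OF that] abc
    by (cases "x > 0") (auto simp: u_def w_def A_eq sgn_if field_simps power2_eq_square)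
  have "(\<lambda>k. sgn s * (1 - q)\<^sup>2 * (1 + a * b * (s * q ^ k)) * (1 + a * c * (s * q ^ k))
        / (b * c * p q a b c (s * q ^ k)))
      \<longlonglongrightarrow> sgn s * (1 - q)\<^sup>2 * (1 + a * b * 0) * (1 + a * c * 0) / (b * c * 1)"
    using abc by (intro tendsto_intros p_tendsto_1 power_tendsto_0 assms) auto
  moreover have "sgn (s * q ^ k) = sgn s" for k
    using q by (simp add: sgn_mult)
  ultimately show ?thesis
    using eq[OF I_mult_power[OF assms]] by (simp add: kappa_def)
qed

lemma summable_w:
  assumes "s \<in> Iq" shows "summable (\<lambda>k. w (s * q ^ k))"
proof -
  have "(\<lambda>k. inverse (p q a b c (s * q ^ k))) \<longlonglongrightarrow> inverse 1"
    by (intro tendsto_intros p_tendsto_1 assms) auto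
  then have "Bseq (\<lambda>k. inverse (p q a b c (s * q ^ k)))"
    using convergentI convergent_imp_Bseq by blast
  then obtain K where K: "\<And>k. \<bar>inverse (p q a b c (s * q ^ k))\<bar> \<le> K"
    by (auto simp: Bseq_def)
  have "summable (\<lambda>k. (1 - q) * \<bar>s\<bar> * K * q ^ k)"
    using q by (intro summable_mult summable_geometric) auto
  moreover have "norm (w (s * q ^ k)) \<le> (1 - q) * \<bar>s\<bar> * K * q ^ k" for k
  proof -
    have "norm (w (s * q ^ k)) = ((1 - q) * \<bar>s\<bar> * q ^ k) * \<bar>inverse (p q a b c (s * q ^ k))\<bar>"
      using q by (simp add: w_def abs_mult divide_inverse mult_ac)
    also have "\<dots> \<le> ((1 - q) * \<bar>s\<bar> * q ^ k) * K"
      using q by (intro mult_left_mono K) auto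
    finally show ?thesis by (simp add: mult_ac)
  qed
  ultimately show ?thesis by (rule summable_comparison_test'[where N = 0])
qed

section \<open>The Hilbert space as a weighted sequence space\<close>

lemma inj_neg: "inj (\<lambda>k::nat. - (q ^ k))"
  using q by (auto intro!: injI simp: power_inject_exp')

lemma inj_orbit: "s \<noteq> 0 \<Longrightarrow> inj (\<lambda>k::nat. s * q ^ k)"
  using q by (auto intro!: injI simp: power_inject_exp')

lemma inj_pos: "inj (\<lambda>k::int. z * q powi k)"
proof (rule injI)
  fix j k :: int assume "z * q powi j = z * q powi k"
  then have "q powi j = q powi k" using z by simp
  then show "j = k"
    using q power_int_strict_decreasing[of j k q] power_int_strict_decreasing[of k j q]
    by (cases j k rule: linorder_cases) auto
qed

lemma I_disjoint: "range (\<lambda>k::nat. - (q ^ k)) \<inter> range (\<lambda>k::int. z * q powi k) = {}"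
proof -
  have "- (q ^ j) < 0" "z * q powi k > 0" for j :: nat and k :: int
    using q z by auto
  then show ?thesis by (smt (verit) disjoint_iff rangeE)
qed

lemma summable_on_I_iff:
  fixes f :: "real \<Rightarrow> 'a :: banach"
  shows "f summable_on Iq \<longleftrightarrow>
    (\<lambda>k. f (- (q ^ k))) summable_on UNIV \<and> (\<lambda>k. f (z * q powi k)) summable_on UNIV"
proof -
  have "f summable_on Iq \<longleftrightarrow> f summable_on range (\<lambda>k::nat. - (q ^ k)) \<and>
      f summable_on range (\<lambda>k::int. z * q powi k)"
    unfolding I_def using I_disjoint by (blast intro: summable_on_Un_disjoint summable_on_subset_banach)
  then show ?thesis
    by (simp add: summable_on_reindex[OF inj_neg] summable_on_reindex[OF inj_pos] o_def)
qed

lemma infsum_I: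
  fixes f :: "real \<Rightarrow> 'a :: banach"
  assumes "f summable_on Iq"
  shows "infsum f Iq = (\<Sum>\<^sub>\<infinity>k. f (- (q ^ k))) + (\<Sum>\<^sub>\<infinity>k. f (z * q powi k))"
proof -
  have "infsum f Iq = infsum f (range (\<lambda>k::nat. - (q ^ k))) + infsum f (range (\<lambda>k::int. z * q powi k))"
    using assms summable_on_subset_banach[OF assms] I_disjoint
    unfolding I_def by (intro infsum_Un_disjoint) (auto simp: I_def)
  then show ?thesis
    by (simp add: infsum_reindex[OF inj_neg] infsum_reindex[OF inj_pos] o_def)
qed

lemma weight_neg_eq: "weight_neg q a b c k = w (- (q ^ k))"
  using q by (simp add: weight_neg_def w_def)

lemma weight_pos_eq: "weight_pos q z a b c k = w (z * q powi k)"
  using q z by (simp add: weight_pos_def w_def abs_mult)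

lemma mem_H_iff:
  "f \<in> Hq \<longleftrightarrow> (\<forall>x. x \<notin> Iq \<longrightarrow> f x = 0) \<and> (\<lambda>x. (cmod (f x))\<^sup>2 * w x) summable_on Iq"
  by (simp add: H_def summable_on_I_iff weight_neg_eq weight_pos_eq)

lemma inner_H_eq:
  assumes "(\<lambda>x. f x * cnj (g x) * of_real (w x)) summable_on Iq"
  shows "inner_H q z a b c f g = (\<Sum>\<^sub>\<infinity>x\<in>Iq. f x * cnj (g x) * of_real (w x))"
  unfolding infsum_I[OF assms] by (simp add: inner_H_def weight_neg_eq weight_pos_eq)

lemma mult_le_sum_squares:
  fixes r s :: real
  assumes "r \<ge> 0" "s \<ge> 0" shows "r * s \<le> r\<^sup>2 + s\<^sup>2"
proof -
  have "r * s \<ge> 0" using assms by simp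
  then show ?thesis using sum_squares_bound[of r s] by linarith
qed

lemma inner_summable:
  assumes "f \<in> Hq" "g \<in> Hq"
  shows "(\<lambda>x. f x * cnj (g x) * of_real (w x)) summable_on Iq"
proof (rule abs_summable_summable, rule Infinite_Sum.abs_summable_on_comparison_test')
  show "(\<lambda>x. (cmod (f x))\<^sup>2 * w x + (cmod (g x))\<^sup>2 * w x) summable_on Iq"
    using assms by (intro summable_on_add) (auto simp: mem_H_iff)
  fix x assume x: "x \<in> Iq"
  have "cmod (f x) * cmod (g x) \<le> (cmod (f x))\<^sup>2 + (cmod (g x))\<^sup>2"
    by (rule mult_le_sum_squares) auto
  then have "cmod (f x) * cmod (g x) * w x \<le> ((cmod (f x))\<^sup>2 + (cmod (g x))\<^sup>2) * w x"
    using w_nonneg[OF x] by (rule mult_right_mono)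
  then show "norm (f x * cnj (g x) * of_real (w x)) \<le> (cmod (f x))\<^sup>2 * w x + (cmod (g x))\<^sup>2 * w x"
    using w_nonneg[OF x] by (simp add: norm_mult algebra_simps)
qed

lemma H_add:
  assumes "f \<in> Hq" "g \<in> Hq" shows "(\<lambda>x. f x + g x) \<in> Hq"
proof -
  have "(\<lambda>x. (cmod (f x + g x))\<^sup>2 * w x) summable_on Iq"
  proof (rule summable_on_comparison_test)
    show "(\<lambda>x. 2 * ((cmod (f x))\<^sup>2 * w x) + 2 * ((cmod (g x))\<^sup>2 * w x)) summable_on Iq"
      using assms by (intro summable_on_add summable_on_cmult_right) (auto simp: mem_H_iff)
    fix x assume x: "x \<in> Iq"
    have "(cmod (f x + g x))\<^sup>2 \<le> (cmod (f x) + cmod (g x))\<^sup>2"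
      by (intro power_mono norm_triangle_ineq) auto
    also have "\<dots> \<le> 2 * (cmod (f x))\<^sup>2 + 2 * (cmod (g x))\<^sup>2"
      using sum_squares_bound[of "cmod (f x)" "cmod (g x)"] by (simp add: power2_sum)
    finally show "(cmod (f x + g x))\<^sup>2 * w x \<le> 2 * ((cmod (f x))\<^sup>2 * w x) + 2 * ((cmod (g x))\<^sup>2 * w x)"
      using mult_right_mono[OF _ w_nonneg[OF x]] by (fastforce simp: algebra_simps)
    show "0 \<le> (cmod (f x + g x))\<^sup>2 * w x" using w_nonneg[OF x] by simp
  qed
  then show ?thesis using assms by (simp add: mem_H_iff)
qed

lemma H_scale:
  assumes "f \<in> Hq" shows "(\<lambda>x. s * f x) \<in> Hq"
proof -
  have "(\<lambda>x. (cmod s)\<^sup>2 * ((cmod (f x))\<^sup>2 * w x)) summable_on Iq"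
    using assms by (intro summable_on_cmult_right) (auto simp: mem_H_iff)
  then show ?thesis
    using assms by (simp add: mem_H_iff norm_mult power_mult_distrib mult.assoc)
qed

text \<open>
  Since the weight is summable near the origin, a function on the lattice with one-sided limits at
  the origin that vanishes at all but finitely many points beyond \<open>z\<close> is in the Hilbert space.
\<close>

lemma mem_H_if_convergent:
  assumes off: "\<And>x. x \<notin> Iq \<Longrightarrow> f x = 0"
    and far: "finite {x \<in> Iq. x > z \<and> f x \<noteq> 0}"
    and conv: "convergent (\<lambda>k. f (z * q ^ k))" "convergent (\<lambda>k. f (- 1 * q ^ k))"
  shows "f \<in> Hq"
proof -
  let ?g = "\<lambda>x. (cmod (f x))\<^sup>2 * w x"
  have near: "?g summable_on range (\<lambda>k::nat. s * q ^ k)"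
    if s: "s \<in> Iq" and c: "convergent (\<lambda>k. f (s * q ^ k))" for s
  proof -
    have s0: "s \<noteq> 0" using I_bound s by auto
    have inj: "inj (\<lambda>k::nat. s * q ^ k)"
      by (rule inj_orbit[OF s0])
    obtain K where K: "\<And>k. cmod (f (s * q ^ k)) \<le> K"
      using convergent_imp_Bseq[OF c] by (auto simp: Bseq_def)
    have "(\<lambda>k. w (s * q ^ k)) summable_on UNIV"
      using summable_w[OF s] w_nonneg[OF I_mult_power[OF s]] by (rule summable_nonneg_imp_summable_on)
    then have "(\<lambda>k. K\<^sup>2 * w (s * q ^ k)) summable_on UNIV" by (rule summable_on_cmult_right)
    then have "(\<lambda>k. ?g (s * q ^ k)) summable_on UNIV"
      by (rule summable_on_comparison_test)
         (auto intro!: mult_right_mono mult_nonneg_nonneg power_mono K w_nonneg I_mult_power s)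
    then show ?thesis by (simp add: summable_on_reindex[OF inj] o_def)
  qed
  let ?N = "range (\<lambda>k::nat. - 1 * q ^ k)" and ?P = "range (\<lambda>k::nat. z * q ^ k)"
    and ?F = "{x \<in> Iq. x > z \<and> f x \<noteq> 0}"
  have "- 1 * q ^ j < 0" "z * q ^ k > 0" for j k :: nat
    using q z by auto
  then have "?N \<inter> ?P = {}" by (smt (verit) disjoint_iff rangeE)
  with near[OF minus_one_in_I conv(2)] near[OF z_in_I conv(1)]
  have 1: "?g summable_on ?N \<union> ?P" by (rule summable_on_Un_disjoint)
  have "?g summable_on (?N \<union> ?P) \<union> (?F - (?N \<union> ?P))"
    by (rule summable_on_Un_disjoint[OF 1]) (use far in auto)
  moreover have "x \<in> (?N \<union> ?P) \<union> (?F - (?N \<union> ?P))" if x: "x \<in> Iq" and nz: "f x \<noteq> 0" for x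
    using x
  proof (cases rule: I_cases)
    case (neg k)
    then show ?thesis by auto
  next
    case (pos k)
    show ?thesis
    proof (cases "k \<ge> 0")
      case True
      then have "x = z * q ^ nat k" using pos by (simp add: power_int_def)
      then show ?thesis by auto
    next
      case False
      then have "q powi k > 1" using power_int_strict_decreasing[of k 0 q] q by simp
      then have "x > z" using pos z by simp
      then show ?thesis using x nz by auto
    qed
  qed
  ultimately have "?g summable_on Iq"
    by (subst (asm) summable_on_cong_neutral[of Iq _ ?g ?g]) (auto simp: off)
  then show ?thesis using off by (simp add: mem_H_iff)
qed

section \<open>Green's formula\<close>

text \<open>The quasi-derivative: its differences along the lattice are \<open>w \<cdot> L f\<close> (lemma \<open>w_L\<close>).\<close>

definition flux :: "(real \<Rightarrow> complex) \<Rightarrow> real \<Rightarrow> complex" where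
  "flux f x = of_real (u x) * (f (q * x) - f x)"

text \<open>The weighted discrete Wronskian (Casorati determinant) of \<open>f\<close> and the conjugate of \<open>g\<close>.\<close>

definition bracket :: "(real \<Rightarrow> complex) \<Rightarrow> (real \<Rightarrow> complex) \<Rightarrow> real \<Rightarrow> complex" where
  "bracket f g x = of_real (u x) * (f (q * x) * cnj (g x) - f x * cnj (g (q * x)))"

lemma bracket_flux: "bracket f g x = flux f x * cnj (g x) - f x * cnj (flux g x)"
  by (simp add: bracket_def flux_def algebra_simps)

lemma w_L:
  assumes "x \<in> Iq" shows "Lq f x * of_real (w x) = flux f x - flux f (x / q)"
proof -
  have "Lq f x * of_real (w x) =
      of_real (A x * w x) * (f (q * x) - f x) + of_real (B x * w x) * (f (x / q) - f x)"
    unfolding L_eq[OF assms] by (simp add: algebra_simps)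
  also have "\<dots> = flux f x - flux f (x / q)"
    using q unfolding B_w[OF assms] by (simp add: flux_def u_def algebra_simps)
  finally show ?thesis .
qed

lemma green_pointwise:
  assumes "x \<in> Iq"
  shows "(Lq f x * cnj (g x) - f x * cnj (Lq g x)) * of_real (w x) = bracket f g x - bracket f g (x / q)"
proof -
  have "(Lq f x * cnj (g x) - f x * cnj (Lq g x)) * of_real (w x) =
      (Lq f x * of_real (w x)) * cnj (g x) - f x * cnj (Lq g x * of_real (w x))"
    by (simp add: algebra_simps)
  also have "\<dots> = bracket f g x - bracket f g (x / q)"
    using q unfolding w_L[OF assms] by (simp add: bracket_def flux_def algebra_simps)
  finally show ?thesis .
qed

abbreviation green_term :: "(real \<Rightarrow> complex) \<Rightarrow> (real \<Rightarrow> complex) \<Rightarrow> real \<Rightarrow> complex" where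
  "green_term f g x \<equiv> (Lq f x * cnj (g x) - f x * cnj (Lq g x)) * of_real (w x)"

lemma green_partial:
  assumes "x \<in> Iq"
  shows "(\<Sum>k\<le>n. green_term f g (x * q ^ k)) = bracket f g (x * q ^ n) - bracket f g (x / q)"
proof (induction n)
  case 0
  then show ?case using green_pointwise[OF assms] by simp
next
  case (Suc n)
  have "x * q ^ Suc n / q = x * q ^ n" using q by simp
  then show ?case
    using Suc green_pointwise[OF I_mult_power[OF assms, of "Suc n"], of f g] by simp
qed

text \<open>There is no boundary term at the end point \<open>-1\<close>, since \<open>u\<close> vanishes at \<open>-1/q\<close>.\<close>

lemma green:
  assumes summ: "green_term f g summable_on Iq"
    and P: "(\<lambda>n. bracket f g (z * q ^ n)) \<longlonglongrightarrow> P"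
    and N: "(\<lambda>n. bracket f g (- 1 * q ^ n)) \<longlonglongrightarrow> N"
    and inf: "(\<lambda>n. bracket f g (z * q powi (- int n - 1))) \<longlonglongrightarrow> 0"
  shows "infsum (green_term f g) Iq = P + N"
proof -
  let ?G = "green_term f g"
  have sN: "(\<lambda>k. ?G (- (q ^ k))) summable_on UNIV" and sP: "(\<lambda>k. ?G (z * q powi k)) summable_on UNIV"
    using iffD1[OF summable_on_I_iff summ] by auto
  have br0: "bracket f g (- 1 / q) = 0"
    using u_left_of_minus_one by (simp add: bracket_def)
  have "(\<lambda>n. \<Sum>k\<le>n. ?G (- (q ^ k))) \<longlonglongrightarrow> (\<Sum>\<^sub>\<infinity>k. ?G (- (q ^ k)))"
    using has_sum_imp_sums[OF has_sum_infsum[OF sN]] by (simp add: sums_def_le)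
  moreover have "(\<lambda>n. \<Sum>k\<le>n. ?G (- (q ^ k))) \<longlonglongrightarrow> N"
    using N green_partial[OF minus_one_in_I, of f g] br0 by simp
  ultimately have n: "(\<Sum>\<^sub>\<infinity>k. ?G (- (q ^ k))) = N" by (rule LIMSEQ_unique)
  have "filterlim (\<lambda>n. {- int n..int n}) (finite_subsets_at_top UNIV) sequentially"
    unfolding filterlim_finite_subsets_at_top
  proof (intro allI impI)
    fix X :: "int set" assume "finite X \<and> X \<subseteq> UNIV"
    then have "finite ((\<lambda>k. nat \<bar>k\<bar>) ` X)" by simp
    then obtain m where m: "\<And>k. k \<in> X \<Longrightarrow> nat \<bar>k\<bar> \<le> m"
      unfolding finite_nat_set_iff_bounded_le by blast
    have "X \<subseteq> {- int n..int n}" if "m \<le> n" for n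
    proof
      fix k assume "k \<in> X"
      from m[OF this] that show "k \<in> {- int n..int n}" by auto
    qed
    then show "\<forall>\<^sub>F n in sequentially. finite {- int n..int n} \<and> X \<subseteq> {- int n..int n} \<and> {- int n..int n} \<subseteq> UNIV"
      by (intro eventually_sequentiallyI[of m]) auto
  qed
  from filterlim_compose[OF infsum_tendsto[OF sP] this]
  have "(\<lambda>n. \<Sum>k\<in>{- int n..int n}. ?G (z * q powi k)) \<longlonglongrightarrow> (\<Sum>\<^sub>\<infinity>k. ?G (z * q powi k))" .
  moreover have "(\<Sum>k\<in>{- int n..int n}. ?G (z * q powi k)) =
      bracket f g (z * q ^ n) - bracket f g (z * q powi (- int n - 1))" for n
  proof -
    have "(\<Sum>k\<in>{- int n..int n}. ?G (z * q powi k)) = (\<Sum>j\<le>2 * n. ?G (z * q powi (- int n) * q ^ j))"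
    proof (rule sum.reindex_bij_witness[of _ "\<lambda>j. int j - int n" "\<lambda>k. nat (k + int n)"])
      fix k assume k: "k \<in> {- int n..int n}"
      have "q powi (- int n) * q ^ nat (k + int n) = q powi (- int n + int (nat (k + int n)))"
        using q by (subst power_int_add) (simp_all only: power_int_of_nat, simp)
      also have "\<dots> = q powi k" using k by simp
      finally show "?G (z * q powi (- int n) * q ^ nat (k + int n)) = ?G (z * q powi k)"
        by (simp only: mult.assoc)
    qed auto
    also have "\<dots> = bracket f g (z * q powi (- int n) * q ^ (2 * n)) - bracket f g (z * q powi (- int n) / q)"
      by (rule green_partial) auto
    also have "z * q powi (- int n) * q ^ (2 * n) = z * q ^ n"
      using q by (simp add: power_int_minus mult_2 power_add)
    also have "z * q powi (- int n) / q = z * q powi (- int n - 1)"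
      using q by (simp add: power_int_diff)
    finally show ?thesis .
  qed
  moreover have "(\<lambda>n. bracket f g (z * q ^ n) - bracket f g (z * q powi (- int n - 1))) \<longlonglongrightarrow> P - 0"
    by (intro tendsto_diff P inf)
  ultimately have p: "(\<Sum>\<^sub>\<infinity>k. ?G (z * q powi k)) = P"
    using LIMSEQ_unique by fastforce
  show ?thesis unfolding infsum_I[OF summ] n p by simp
qed

section \<open>Boundary values\<close>

subsection \<open>The limit-point end at infinity\<close>

lemma H_weighted_summable:
  assumes "f \<in> Hq" "inj_on h UNIV" "\<And>n::nat. h n \<in> Iq"
  shows "summable (\<lambda>n. (cmod (f (h n)))\<^sup>2 * w (h n))"
proof -
  have "(\<lambda>x. (cmod (f x))\<^sup>2 * w x) summable_on range h"
    by (rule summable_on_subset_banach[where A = Iq]) (use assms in \<open>auto simp: mem_H_iff\<close>)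
  then have "(\<lambda>n. (cmod (f (h n)))\<^sup>2 * w (h n)) summable_on UNIV"
    using summable_on_reindex[OF assms(2), of "\<lambda>x. (cmod (f x))\<^sup>2 * w x"] by (simp add: o_def)
  then show ?thesis by (rule summable_on_imp_summable)
qed

lemma bracket_infinity:
  assumes f: "f \<in> Hq" and g: "g \<in> Hq"
  shows "(\<lambda>n. bracket f g (z * q powi (- int n - 1))) \<longlonglongrightarrow> 0"
proof -
  define x where "x n = z * q powi (- int n - 1)" for n :: nat
  have qx: "q * x n = z * q powi (- int n)" for n
    using q by (simp add: x_def power_int_diff)
  have injx: "inj x"
  proof (rule injI)
    fix m n assume "x m = x n"
    from injD[OF inj_pos this[unfolded x_def]] show "m = n" by simp
  qed
  have injqx: "inj (\<lambda>n. q * x n)"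
  proof (rule injI)
    fix m n assume "q * x m = q * x n"
    then have "x m = x n" using q by simp
    then show "m = n" by (rule injD[OF injx])
  qed
  have xI: "x n \<in> Iq" and qxI: "q * x n \<in> Iq" for n
    using I_mult_q by (auto simp: x_def)
  define C where "C = A z + B z"
  have "q powi (- int n) \<ge> 1" for n
    using q by (simp add: power_int_minus one_le_inverse_iff power_le_one)
  then have qxz: "q * x n \<ge> z" for n
    using z by (simp add: qx)
  have xz: "x n \<ge> z" for n
  proof -
    have "0 < x n" using q z by (simp add: x_def)
    then have "q * x n \<le> x n" using q by (simp add: mult_left_le_one_le)
    then show ?thesis using qxz[of n] by simp
  qed
  have ABpos: "A z > 0" "B z > 0"
    using z abc q by (auto simp: coeffA_def coeffB_def intro!: mult_pos_pos add_pos_pos)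
  have frac: "1 + r / (t * y) \<le> 1 + r / (t * z)" "0 \<le> 1 + r / (t * y)"
    if "y \<ge> z" "t > 0" "r > 0" for r t y
  proof -
    have "t * z \<le> t * y" using that by simp
    then have "r / (t * y) \<le> r / (t * z)" using that z by (intro frac_le) auto
    moreover have "r / (t * y) \<ge> 0" using that z by simp
    ultimately show "1 + r / (t * y) \<le> 1 + r / (t * z)" "0 \<le> 1 + r / (t * y)" by simp_all
  qed
  have A_le: "A y \<le> A z" if "y \<ge> z" for y
    unfolding coeffA_def mult.assoc[of "a\<^sup>2"]
    by (rule mult_left_mono[OF mult_mono]) (use frac[OF that] frac[OF order_refl] abc in auto)
  have B_le: "B y \<le> B z" if "y \<ge> z" for y
    unfolding coeffB_def
    by (rule mult_mono)
      (use frac[OF that] frac[OF order_refl] frac[OF that, of 1 1] frac[OF order_refl, of 1 1] abc q in auto)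
  \<comment> \<open>\<open>A\<close> and \<open>B\<close> decrease on the positive half-line, so \<open>u x\<close> is controlled by the weight at both points
    that enter the bracket: near infinity \<open>L\<close> is a bounded Jacobi operator.\<close>
  have u1: "u (x n) \<le> C * w (x n)" for n
    unfolding u_def C_def using A_le[OF xz[of n]] ABpos w_nonneg[OF xI] by (intro mult_right_mono) auto
  have u2: "u (x n) \<le> C * w (q * x n)" for n
    unfolding B_w_mult_q[OF xI, symmetric] C_def
    using B_le[OF qxz[of n]] ABpos w_nonneg[OF qxI] by (intro mult_right_mono) auto
  have half: "norm (of_real (u (x n)) * (r * s)) \<le>
      C * ((cmod r)\<^sup>2 * w (q * x n) + (cmod s)\<^sup>2 * w (x n))" for r s n
  proof -
    have u0: "u (x n) \<ge> 0" using u_pos[OF xI[of n]] by simp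
    have "cmod r * cmod s \<le> (cmod r)\<^sup>2 + (cmod s)\<^sup>2"
      by (rule mult_le_sum_squares) auto
    then have "norm (of_real (u (x n)) * (r * s)) \<le> u (x n) * ((cmod r)\<^sup>2 + (cmod s)\<^sup>2)"
      using u0 by (simp add: norm_mult mult_left_mono)
    also have "\<dots> \<le> (C * w (q * x n)) * (cmod r)\<^sup>2 + (C * w (x n)) * (cmod s)\<^sup>2"
      unfolding distrib_left using u1 u2 by (intro add_mono mult_right_mono) auto
    finally show ?thesis by (simp add: algebra_simps)
  qed
  have "norm (bracket f g (x n)) \<le>
      C * ((cmod (f (q * x n)))\<^sup>2 * w (q * x n) + (cmod (g (x n)))\<^sup>2 * w (x n)) +
      C * ((cmod (g (q * x n)))\<^sup>2 * w (q * x n) + (cmod (f (x n)))\<^sup>2 * w (x n))" for n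
  proof -
    have "bracket f g (x n) = of_real (u (x n)) * (f (q * x n) * cnj (g (x n))) -
        of_real (u (x n)) * (cnj (g (q * x n)) * f (x n))"
      by (simp add: bracket_def algebra_simps)
    also have "norm \<dots> \<le> norm (of_real (u (x n)) * (f (q * x n) * cnj (g (x n)))) +
        norm (of_real (u (x n)) * (cnj (g (q * x n)) * f (x n)))"
      by (rule norm_triangle_ineq4)
    finally show ?thesis
      using half[of n "f (q * x n)" "cnj (g (x n))"] half[of n "cnj (g (q * x n))" "f (x n)"] by simp
  qed
  moreover have "(\<lambda>n. C * ((cmod (f (q * x n)))\<^sup>2 * w (q * x n) + (cmod (g (x n)))\<^sup>2 * w (x n)) +
      C * ((cmod (g (q * x n)))\<^sup>2 * w (q * x n) + (cmod (f (x n)))\<^sup>2 * w (x n))) \<longlonglongrightarrow> 0"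
    by (intro tendsto_add_zero tendsto_mult_right_zero
        H_weighted_summable[OF f injx xI, THEN summable_LIMSEQ_zero]
        H_weighted_summable[OF f injqx qxI, THEN summable_LIMSEQ_zero]
        H_weighted_summable[OF g injx xI, THEN summable_LIMSEQ_zero]
        H_weighted_summable[OF g injqx qxI, THEN summable_LIMSEQ_zero])
  ultimately have "(\<lambda>n. bracket f g (x n)) \<longlonglongrightarrow> 0"
    by (rule Lim_null_comparison[OF always_eventually[OF allI]])
  then show ?thesis by (simp add: x_def)
qed

subsection \<open>Boundary values at the origin\<close>

lemma Dq_flux:
  assumes "x \<in> Iq"
  shows "of_real ((1 - q) * x * u x) * Dq q f x = - flux f x"
proof -
  define v where "v = (1 - q) * x"
  have "v \<noteq> 0" using I_bound[OF assms] q by (simp add: v_def)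
  then show ?thesis
    unfolding v_def[symmetric] Dq_def flux_def by (simp add: field_simps)
qed

lemma bracket_origin:
  assumes s: "s \<in> Iq"
    and f: "(\<lambda>k. f (s * q ^ k)) \<longlonglongrightarrow> f0" "(\<lambda>k. Dq q f (s * q ^ k)) \<longlonglongrightarrow> f1"
    and g: "(\<lambda>k. g (s * q ^ k)) \<longlonglongrightarrow> g0" "(\<lambda>k. Dq q g (s * q ^ k)) \<longlonglongrightarrow> g1"
  shows "(\<lambda>k. bracket f g (s * q ^ k)) \<longlonglongrightarrow> of_real (sgn s * kappa) * (f0 * cnj g1 - f1 * cnj g0)"
proof -
  let ?x = "\<lambda>k. s * q ^ k"
  have "bracket f g (?x k) = of_real ((1 - q) * ?x k * u (?x k)) *
      (f (?x k) * cnj (Dq q g (?x k)) - Dq q f (?x k) * cnj (g (?x k)))" for k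
  proof -
    define v where "v = (1 - q) * ?x k * u (?x k)"
    have "flux h (?x k) = - (of_real v * Dq q h (?x k))" for h
      using Dq_flux[OF I_mult_power[OF s], of k h] by (simp add: v_def)
    then show ?thesis unfolding v_def[symmetric] bracket_flux by (simp add: algebra_simps)
  qed
  then show ?thesis
    using tendsto_mult[OF tendsto_of_real[OF u_tendsto[OF s]]
        tendsto_diff[OF tendsto_mult[OF f(1) tendsto_cnj[OF g(2)]] tendsto_mult[OF f(2) tendsto_cnj[OF g(1)]]]]
    by (simp only:)
qed

text \<open>
  The origin is a regular end point: if \<open>f\<close> and \<open>L f\<close> lie in the Hilbert space, then the flux has a
  limit, because its increments \<open>w \<cdot> L f\<close> are absolutely summable.
\<close>

lemma boundary_values_exist:
  assumes s: "s \<in> Iq" and f: "f \<in> Hq" and Lf: "Lq f \<in> Hq"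
  obtains f0 f1 where "(\<lambda>k. f (s * q ^ k)) \<longlonglongrightarrow> f0" "(\<lambda>k. Dq q f (s * q ^ k)) \<longlonglongrightarrow> f1"
proof -
  define x where "x k = s * q ^ k" for k :: nat
  have s0: "s \<noteq> 0" using I_bound s by auto
  have xI: "x k \<in> Iq" for k unfolding x_def by (rule I_mult_power[OF s])
  have xq: "q * x k = x (Suc k)" for k by (simp add: x_def)
  have xSuc: "x (Suc k) / q = x k" for k using q by (simp add: x_def)
  have injx: "inj x"
    using inj_orbit[OF s0] by (simp add: x_def inj_def)
  have "summable (\<lambda>k. (cmod (Lq f (x k)))\<^sup>2 * w (x k))"
    by (rule H_weighted_summable[OF Lf injx xI])
  then have "summable (\<lambda>k. w (x k) + (cmod (Lq f (x k)))\<^sup>2 * w (x k))"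
    using summable_w[OF s] by (intro summable_add) (simp_all add: x_def)
  moreover have "norm (Lq f (x k) * of_real (w (x k))) \<le> w (x k) + (cmod (Lq f (x k)))\<^sup>2 * w (x k)" for k
  proof -
    have "cmod (Lq f (x k)) \<le> 1 + (cmod (Lq f (x k)))\<^sup>2"
      using mult_le_sum_squares[of 1 "cmod (Lq f (x k))"] by simp
    from mult_right_mono[OF this w_nonneg[OF xI]] show ?thesis
      using w_nonneg[OF xI] by (simp add: norm_mult distrib_right)
  qed
  ultimately have "summable (\<lambda>k. Lq f (x k) * of_real (w (x k)))"
    by (rule summable_comparison_test'[where N = 0])
  then have "summable (\<lambda>k. Lq f (x (Suc k)) * of_real (w (x (Suc k))))"
    using summable_Suc_iff[of "\<lambda>k. Lq f (x k) * of_real (w (x k))"] by simp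
  then have "summable (\<lambda>k. flux f (x (Suc k)) - flux f (x k))"
    using w_L[OF xI] xSuc by simp
  then have "convergent (\<lambda>n. flux f (x n) - flux f (x 0))"
    unfolding summable_iff_convergent sum_lessThan_telescope[of "\<lambda>n. flux f (x n)"] .
  then obtain l where "(\<lambda>n. flux f (x n) - flux f (x 0)) \<longlonglongrightarrow> l" by (auto simp: convergent_def)
  from tendsto_add[OF this tendsto_const[of "flux f (x 0)"]]
  have fl: "(\<lambda>n. flux f (x n)) \<longlonglongrightarrow> l + flux f (x 0)" by simp
  have "Dq q f (x n) = - flux f (x n) / of_real ((1 - q) * x n * u (x n))" for n
  proof -
    have "(1 - q) * x n * u (x n) \<noteq> 0"
      using q u_pos[OF xI[of n]] I_bound[OF xI[of n]] by simp
    then have "complex_of_real ((1 - q) * x n * u (x n)) \<noteq> 0" by (subst of_real_eq_0_iff)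
    from nonzero_mult_div_cancel_left[OF this, of "Dq q f (x n)"] show ?thesis
      unfolding Dq_flux[OF xI] by (rule sym)
  qed
  moreover have "(\<lambda>n. - flux f (x n) / of_real ((1 - q) * x n * u (x n))) \<longlonglongrightarrow>
      - (l + flux f (x 0)) / of_real (sgn s * kappa)"
    using kappa_pos s0
    by (intro tendsto_divide[OF tendsto_minus[OF fl] tendsto_of_real[OF u_tendsto[OF s, folded x_def]]])
       (auto simp: sgn_if)
  ultimately have D: "(\<lambda>n. Dq q f (x n)) \<longlonglongrightarrow> - (l + flux f (x 0)) / of_real (sgn s * kappa)"
    by simp
  then obtain K where K: "\<And>n. cmod (Dq q f (x n)) \<le> K"
    using convergent_imp_Bseq[OF convergentI[OF D]] by (auto simp: Bseq_def)
  have "summable (\<lambda>k. ((1 - q) * \<bar>s\<bar> * K) * q ^ k)"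
    using q by (intro summable_mult summable_geometric) auto
  moreover have "norm (f (x (Suc k)) - f (x k)) \<le> ((1 - q) * \<bar>s\<bar> * K) * q ^ k" for k
  proof -
    define v where "v = (1 - q) * x k"
    have "v \<noteq> 0" using q I_bound[OF xI[of k]] by (simp add: v_def)
    then have "f (x (Suc k)) - f (x k) = - (of_real v * Dq q f (x k))"
      by (simp add: Dq_def xq v_def[symmetric])
    then have "norm (f (x (Suc k)) - f (x k)) = \<bar>v\<bar> * cmod (Dq q f (x k))"
      by (simp add: norm_mult)
    also have "\<dots> \<le> \<bar>v\<bar> * K"
      by (intro mult_left_mono K) auto
    also have "\<bar>v\<bar> = (1 - q) * \<bar>s\<bar> * q ^ k"
      using q by (simp add: v_def x_def abs_mult)
    finally show ?thesis by (simp add: mult_ac)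
  qed
  ultimately have "summable (\<lambda>k. f (x (Suc k)) - f (x k))"
    by (rule summable_comparison_test'[where N = 0])
  then have "convergent (\<lambda>n. f (x n) - f (x 0))"
    unfolding summable_iff_convergent sum_lessThan_telescope[of "\<lambda>n. f (x n)"] .
  then obtain m where "(\<lambda>n. f (x n) - f (x 0)) \<longlonglongrightarrow> m" by (auto simp: convergent_def)
  from tendsto_add[OF this tendsto_const[of "f (x 0)"]]
  have "(\<lambda>n. f (x n)) \<longlonglongrightarrow> m + f (x 0)" by simp
  with D show thesis unfolding x_def by (rule that[rotated])
qed

subsection \<open>The boundary form\<close>

abbreviation ip :: "(real \<Rightarrow> complex) \<Rightarrow> (real \<Rightarrow> complex) \<Rightarrow> complex" where
  "ip \<equiv> inner_H q z a b c"

lemma ip_eq: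
  assumes "f \<in> Hq" "g \<in> Hq"
  shows "ip f g = (\<Sum>\<^sub>\<infinity>x\<in>Iq. f x * cnj (g x) * of_real (w x))"
  using inner_summable[OF assms] by (rule inner_H_eq)

lemma has_sum_diff:
  fixes f g :: "'a \<Rightarrow> complex"
  assumes "(f has_sum s) M" "(g has_sum t) M"
  shows "((\<lambda>x. f x - g x) has_sum (s - t)) M"
  using has_sum_add[OF assms(1), of "\<lambda>x. - g x" "- t"] assms(2) by (simp add: has_sum_uminus)

lemma inner_green:
  assumes f: "f \<in> Hq" "Lq f \<in> Hq" and g: "g \<in> Hq" "Lq g \<in> Hq"
    and fz: "(\<lambda>k. f (z * q ^ k)) \<longlonglongrightarrow> f0" "(\<lambda>k. Dq q f (z * q ^ k)) \<longlonglongrightarrow> f1"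
    and gz: "(\<lambda>k. g (z * q ^ k)) \<longlonglongrightarrow> g0" "(\<lambda>k. Dq q g (z * q ^ k)) \<longlonglongrightarrow> g1"
    and fn: "(\<lambda>k. f (- 1 * q ^ k)) \<longlonglongrightarrow> e0" "(\<lambda>k. Dq q f (- 1 * q ^ k)) \<longlonglongrightarrow> e1"
    and gn: "(\<lambda>k. g (- 1 * q ^ k)) \<longlonglongrightarrow> h0" "(\<lambda>k. Dq q g (- 1 * q ^ k)) \<longlonglongrightarrow> h1"
  shows "ip (Lq f) g - ip f (Lq g) =
    of_real kappa * ((f0 * cnj g1 - f1 * cnj g0) - (e0 * cnj h1 - e1 * cnj h0))"
proof -
  have eq: "green_term f g =
      (\<lambda>x. Lq f x * cnj (g x) * of_real (w x) - f x * cnj (Lq g x) * of_real (w x))"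
    by (simp add: fun_eq_iff algebra_simps)
  have hs: "(green_term f g has_sum (ip (Lq f) g - ip f (Lq g))) Iq"
    unfolding ip_eq[OF f(2) g(1)] ip_eq[OF f(1) g(2)] eq
    by (intro has_sum_diff has_sum_infsum inner_summable f g)
  then have S: "green_term f g summable_on Iq" by (rule has_sum_imp_summable)
  have "ip (Lq f) g - ip f (Lq g) = infsum (green_term f g) Iq"
    using hs by (rule infsumI[symmetric])
  also have "\<dots> = of_real (sgn z * kappa) * (f0 * cnj g1 - f1 * cnj g0) +
      of_real (sgn (- 1) * kappa) * (e0 * cnj h1 - e1 * cnj h0)"
    by (rule green[OF S bracket_origin[OF z_in_I fz gz] bracket_origin[OF minus_one_in_I fn gn]
          bracket_infinity[OF f(1) g(1)]])
  finally show ?thesis using z by (simp add: algebra_simps)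
qed

section \<open>Test functions\<close>

subsection \<open>Functions of finite support\<close>

lemma eventually_orbit_zero:
  assumes "finite {x. f x \<noteq> 0}" "s \<in> Iq"
  shows "\<forall>\<^sub>F k in sequentially. f (s * q ^ k) = 0"
proof -
  have "s \<noteq> 0" using I_bound assms by auto
  then have "finite ((\<lambda>k. s * q ^ k) -` {x. f x \<noteq> 0})"
    by (intro finite_vimageI assms inj_orbit)
  then show ?thesis
    by (simp add: cofinite_eq_sequentially[symmetric] eventually_cofinite vimage_def)
qed

lemma finite_support_L:
  assumes "finite {x. f x \<noteq> 0}"
  shows "finite {x. Lq f x \<noteq> 0}"
proof (rule finite_subset)
  let ?S = "{x. f x \<noteq> 0}"
  show "{x. Lq f x \<noteq> 0} \<subseteq> ?S \<union> (\<lambda>y. y / q) ` ?S \<union> (\<lambda>y. q * y) ` ?S"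
  proof
    fix x assume "x \<in> {x. Lq f x \<noteq> 0}"
    then have nz: "Lq f x \<noteq> 0" by simp
    then have "x \<in> Iq" using L_off_I by blast
    with nz have "f x \<noteq> 0 \<or> f (q * x) \<noteq> 0 \<or> f (x / q) \<noteq> 0" by (auto simp: L_eq)
    moreover have "x = q * x / q" "x = q * (x / q)" using q by auto
    ultimately show "x \<in> ?S \<union> (\<lambda>y. y / q) ` ?S \<union> (\<lambda>y. q * y) ` ?S" by blast
  qed
qed (use assms in auto)

lemma finite_support_H:
  assumes off: "\<And>x. x \<notin> Iq \<Longrightarrow> f x = 0" and fin: "finite {x. f x \<noteq> 0}"
  shows "f \<in> Hq"
proof (rule mem_H_if_convergent[OF off])
  show "finite {x \<in> Iq. z < x \<and> f x \<noteq> 0}" by (rule finite_subset[OF _ fin]) auto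
  show "convergent (\<lambda>k. f (z * q ^ k))" "convergent (\<lambda>k. f (- 1 * q ^ k))"
    by (rule convergentI, rule tendsto_eventually, rule eventually_orbit_zero[OF fin], simp)+
qed

lemma finite_support_Dq:
  assumes fin: "finite {x. f x \<noteq> 0}" and s: "s \<in> Iq"
  shows "\<forall>\<^sub>F k in sequentially. Dq q f (s * q ^ k) = 0"
proof -
  have "\<forall>\<^sub>F k in sequentially. f (s * q ^ Suc k) = 0"
    using eventually_orbit_zero[OF assms] by (subst eventually_sequentially_Suc)
  with eventually_orbit_zero[OF assms] show ?thesis
    by eventually_elim (simp add: Dq_def mult_ac)
qed

lemma finite_support_D:
  assumes off: "\<And>x. x \<notin> Iq \<Longrightarrow> f x = 0" and fin: "finite {x. f x \<noteq> 0}"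
  shows "f \<in> D q z a b c \<alpha>"
proof -
  have "Lq f \<in> Hq" by (rule finite_support_H[OF L_off_I finite_support_L[OF fin]])
  moreover have "(\<lambda>k. f (s * q ^ k)) \<longlonglongrightarrow> 0" "(\<lambda>k. Dq q f (s * q ^ k)) \<longlonglongrightarrow> 0" if "s \<in> Iq" for s
    using eventually_orbit_zero[OF fin that] finite_support_Dq[OF fin that]
    by (auto intro: tendsto_eventually)
  from this[OF z_in_I] this[OF minus_one_in_I]
  have "\<exists>fpos fneg dpos dneg. (\<lambda>k::nat. f (z * q ^ k)) \<longlonglongrightarrow> fpos \<and>
           (\<lambda>k::nat. f (- (q ^ k))) \<longlonglongrightarrow> fneg \<and>
           (\<lambda>k::nat. Dq q f (z * q ^ k)) \<longlonglongrightarrow> dpos \<and>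
           (\<lambda>k::nat. Dq q f (- (q ^ k))) \<longlonglongrightarrow> dneg \<and>
           fpos = \<alpha> * fneg \<and> dpos = \<alpha> * dneg"
    by (intro exI[of _ 0]) simp
  ultimately show ?thesis
    using finite_support_H[OF off fin] by (simp add: D_def)
qed

lemma dense_D: "dense_in Hq ip (D q z a b c \<alpha>)"
  unfolding dense_in_def
proof (intro conjI ballI allI impI)
  show "D q z a b c \<alpha> \<subseteq> Hq" by (auto simp: D_def)
  fix f :: "real \<Rightarrow> complex" and e :: real assume f: "f \<in> Hq" and e: "e > 0"
  let ?F = "\<lambda>x. (cmod (f x))\<^sup>2 * w x"
  have S: "?F summable_on Iq" using f by (simp add: mem_H_iff)
  have "\<forall>\<^sub>F X in finite_subsets_at_top Iq. dist (sum ?F X) (infsum ?F Iq) < e\<^sup>2"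
    using infsum_tendsto[OF S] e by (intro tendstoD) auto
  then obtain X where X: "finite X" "X \<subseteq> Iq" and d: "dist (sum ?F X) (infsum ?F Iq) < e\<^sup>2"
    unfolding eventually_finite_subsets_at_top by blast
  define g where "g x = (if x \<in> X then f x else 0)" for x
  have "finite {x. g x \<noteq> 0}" by (rule finite_subset[OF _ X(1)]) (auto simp: g_def)
  then have g: "g \<in> D q z a b c \<alpha>" using X by (intro finite_support_D) (auto simp: g_def)
  let ?h = "\<lambda>x. f x - g x"
  have "ip ?h ?h = of_real (infsum ?F (Iq - X))"
  proof -
    have eq: "?h x * cnj (?h x) * of_real (w x) = of_real (if x \<in> X then 0 else ?F x)" for x
      by (simp add: g_def complex_norm_square[symmetric])
    have "?F summable_on (Iq - X)" by (rule summable_on_subset_banach[OF S]) auto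
    then have S': "(\<lambda>x. if x \<in> X then 0 else ?F x) summable_on Iq"
      by (rule iffD1[OF summable_on_cong_neutral, rotated 3]) auto
    have hs: "((\<lambda>x. ?h x * cnj (?h x) * of_real (w x)) has_sum
        of_real (\<Sum>\<^sub>\<infinity>x\<in>Iq. if x \<in> X then 0 else ?F x)) Iq"
      unfolding eq by (intro has_sum_of_real has_sum_infsum S')
    have "ip ?h ?h = of_real (\<Sum>\<^sub>\<infinity>x\<in>Iq. if x \<in> X then 0 else ?F x)"
      using inner_H_eq[OF has_sum_imp_summable[OF hs]] infsumI[OF hs] by (rule trans)
    also have "(\<Sum>\<^sub>\<infinity>x\<in>Iq. if x \<in> X then 0 else ?F x) = infsum ?F (Iq - X)"
      by (rule infsum_cong_neutral) auto
    finally show ?thesis .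
  qed
  moreover have "infsum ?F (Iq - X) = infsum ?F Iq - sum ?F X"
    using infsum_Diff[OF S _ X(2)] X(1) by simp
  moreover have "\<dots> < e\<^sup>2" using d by (simp add: dist_real_def)
  ultimately have "hnorm ip ?h < e"
    unfolding hnorm_def using e real_sqrt_less_mono[of "infsum ?F Iq - sum ?F X" "e\<^sup>2"] by simp
  then show "\<exists>g\<in>D q z a b c \<alpha>. hnorm ip (\<lambda>x. f x - g x) < e" using g by blast
qed

text \<open>The point mass at \<open>y\<close>.\<close>

definition delta :: "real \<Rightarrow> real \<Rightarrow> complex" where
  "delta y x = (if x = y then 1 else 0)"

lemma delta_D: "y \<in> Iq \<Longrightarrow> delta y \<in> D q z a b c \<alpha>"
  by (rule finite_support_D) (auto simp: delta_def)

lemma delta_H: "y \<in> Iq \<Longrightarrow> delta y \<in> Hq"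
  by (rule finite_support_H) (auto simp: delta_def)

lemma L_delta_H: "y \<in> Iq \<Longrightarrow> Lq (delta y) \<in> Hq"
  by (rule finite_support_H[OF L_off_I finite_support_L]) (auto simp: delta_def)

lemma has_sum_delta:
  assumes "y \<in> Iq"
  shows "((\<lambda>x. delta y x * cnj (h x) * of_real (w x)) has_sum cnj (h y) * of_real (w y)) Iq"
  by (rule has_sum_finite_neutralI[of "{y}"]) (use assms in \<open>auto simp: delta_def\<close>)

lemma inner_delta:
  assumes "y \<in> Iq"
  shows "ip (delta y) h = cnj (h y) * of_real (w y)"
  using has_sum_delta[OF assms, of h] by (subst inner_H_eq) (auto simp: has_sum_iff)

text \<open>
  Here \<open>L g\<close> need not lie in the Hilbert space and \<open>g\<close> need not have boundary values, because the
  bracket of a function of finite support with \<open>g\<close> vanishes near the origin.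
\<close>

lemma inner_L_delta:
  assumes y: "y \<in> Iq" and g: "g \<in> Hq"
  shows "ip (Lq (delta y)) g = cnj (Lq g y) * of_real (w y)"
proof -
  let ?d = "delta y"
  have fin: "finite {x. ?d x \<noteq> 0}" by (auto simp: delta_def)
  have eq: "green_term ?d g =
      (\<lambda>x. Lq ?d x * cnj (g x) * of_real (w x) - ?d x * cnj (Lq g x) * of_real (w x))"
    by (simp add: fun_eq_iff algebra_simps)
  note S1 = inner_summable[OF L_delta_H[OF y] g]
  note S2 = has_sum_delta[OF y, of "Lq g"]
  have br: "(\<lambda>k. bracket ?d g (s * q ^ k)) \<longlonglongrightarrow> 0" if s: "s \<in> Iq" for s
  proof (rule tendsto_eventually)
    have "\<forall>\<^sub>F k in sequentially. ?d (s * q ^ Suc k) = 0"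
      using eventually_orbit_zero[OF fin s] by (subst eventually_sequentially_Suc)
    with eventually_orbit_zero[OF fin s] show "\<forall>\<^sub>F k in sequentially. bracket ?d g (s * q ^ k) = 0"
      by eventually_elim (simp add: bracket_def mult_ac)
  qed
  have hs: "(green_term ?d g has_sum (ip (Lq ?d) g - cnj (Lq g y) * of_real (w y))) Iq"
    unfolding eq ip_eq[OF L_delta_H[OF y] g] by (intro has_sum_diff has_sum_infsum S1 S2)
  then have "infsum (green_term ?d g) Iq = 0 + 0"
    by (intro green[OF has_sum_imp_summable br[OF z_in_I] br[OF minus_one_in_I]
          bracket_infinity[OF delta_H[OF y] g]])
  with infsumI[OF hs] show ?thesis by simp
qed

text \<open>An adjoint value can only be \<open>L g\<close>, computed pointwise.\<close>

lemma adjoint_value: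
  assumes g: "g \<in> Hq" and h: "h \<in> Hq"
    and adj: "\<And>f. f \<in> D q z a b c \<alpha> \<Longrightarrow> ip (Lq f) g = ip f h"
  shows "h = Lq g"
proof
  fix y
  show "h y = Lq g y"
  proof (cases "y \<in> Iq")
    case True
    have "cnj (Lq g y) * of_real (w y) = cnj (h y) * of_real (w y)"
      using adj[OF delta_D[OF True]] inner_L_delta[OF True g] inner_delta[OF True] by simp
    then show ?thesis using w_pos[OF True] by simp
  next
    case False
    then show ?thesis using h by (simp add: mem_H_iff L_off_I)
  qed
qed

subsection \<open>Functions with prescribed boundary values\<close>

text \<open>
  The function \<open>\<beta> + \<gamma> x\<close> on the negative half of the lattice and \<open>\<alpha> (\<beta> + \<gamma> x)\<close> on the positive half,
  cut off beyond \<open>z\<close>. Its boundary values at \<open>0-\<close> are \<open>\<beta>\<close> and \<open>\<gamma>\<close>, which can be chosen freely.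
\<close>

definition affine_germ :: "complex \<Rightarrow> complex \<Rightarrow> complex \<Rightarrow> real \<Rightarrow> complex" where
  "affine_germ \<alpha> \<beta> \<gamma> x =
     (if x \<in> Iq \<and> x \<le> z then (if x < 0 then 1 else \<alpha>) * (\<beta> + \<gamma> * of_real x) else 0)"

text \<open>The scalar \<open>e\<close> is the factor in front of \<open>\<beta> + \<gamma> x\<close> on the half of the lattice that contains \<open>s\<close>.\<close>

lemma affine_germ_orbit:
  assumes "s = z \<and> e = \<alpha> \<or> s = -1 \<and> e = 1"
  shows "affine_germ \<alpha> \<beta> \<gamma> (s * q ^ k) = e * (\<beta> + \<gamma> * of_real (s * q ^ k))"
proof -
  have qk: "q ^ k \<le> 1" "q ^ k > 0" using q by (auto simp: power_le_one)
  have "s \<in> Iq" using assms by auto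
  then have "s * q ^ k \<in> Iq" by (rule I_mult_power)
  moreover have "s * q ^ k \<le> z"
    using assms qk z by (auto simp: mult_left_le)
  moreover have "s * q ^ k < 0 \<longleftrightarrow> s < 0" using q by (simp add: mult_less_0_iff)
  ultimately show ?thesis using assms z by (auto simp: affine_germ_def)
qed

lemma L_affine_germ_orbit:
  assumes e: "s = z \<and> e = \<alpha> \<or> s = -1 \<and> e = 1"
  shows "convergent (\<lambda>k. Lq (affine_germ \<alpha> \<beta> \<gamma>) (s * q ^ k))"
proof -
  let ?f = "affine_germ \<alpha> \<beta> \<gamma>"
  define m where "m = (b * c / q + 1 - a * b - a * c) / (b * c)"
  define r where "r = 1 / q - a\<^sup>2"
  have s: "s \<in> Iq" using e by auto
  \<comment> \<open>The double poles of \<open>B / q\<close> and \<open>A\<close> at 0 cancel, which keeps \<open>L\<close> of an affine function bounded.\<close>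
  have coeff: "x * (B x / q - A x) = m + x * r" if "x \<noteq> 0" for x
    using that abc q unfolding A_eq[OF that] B_eq[OF that] m_def r_def
    by (simp add: divide_simps) (simp add: algebra_simps power2_eq_square)
  \<comment> \<open>For \<open>x = z\<close> the point \<open>x / q\<close> lies beyond the cut-off, so the formula starts one step later.\<close>
  have "Lq ?f (s * q ^ Suc k) = e * \<gamma> * of_real ((1 - q) * (m + s * q ^ Suc k * r))" for k
  proof -
    define x where "x = s * q ^ Suc k"
    have xI: "x \<in> Iq" unfolding x_def by (rule I_mult_power[OF s])
    have x0: "x \<noteq> 0" using I_bound[OF xI] by simp
    have v: "?f x = e * (\<beta> + \<gamma> * of_real x)"
      unfolding x_def by (rule affine_germ_orbit[OF e])
    have vq: "?f (q * x) = e * (\<beta> + \<gamma> * of_real (q * x))"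
      using affine_germ_orbit[OF e, of \<beta> \<gamma> "Suc (Suc k)"] by (simp add: x_def mult_ac)
    have "x / q = s * q ^ k" using q by (simp add: x_def)
    then have vd: "?f (x / q) = e * (\<beta> + \<gamma> * of_real (x / q))"
      using affine_germ_orbit[OF e, of \<beta> \<gamma> k] by simp
    have "Lq ?f x = e * \<gamma> * of_real (A x * (q * x - x) + B x * (x / q - x))"
      unfolding L_eq[OF xI] v vq vd of_real_add of_real_diff of_real_mult by (simp add: algebra_simps)
    also have "A x * (q * x - x) + B x * (x / q - x) = (1 - q) * (x * (B x / q - A x))"
      using q by (simp add: field_simps)
    finally show ?thesis unfolding coeff[OF x0] unfolding x_def .
  qed
  moreover have "(\<lambda>k. e * \<gamma> * of_real ((1 - q) * (m + s * q ^ Suc k * r))) \<longlonglongrightarrow>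
      e * \<gamma> * of_real ((1 - q) * (m + 0 * r))"
    by (intro tendsto_intros LIMSEQ_Suc[OF power_tendsto_0])
  ultimately have "(\<lambda>k. Lq ?f (s * q ^ Suc k)) \<longlonglongrightarrow> e * \<gamma> * of_real ((1 - q) * (m + 0 * r))"
    by simp
  then show ?thesis by (rule convergentI[OF LIMSEQ_imp_Suc])
qed

lemma affine_germ_H: "affine_germ \<alpha> \<beta> \<gamma> \<in> Hq"
proof (rule mem_H_if_convergent)
  have "convergent (\<lambda>k. affine_germ \<alpha> \<beta> \<gamma> (s * q ^ k))" if "s = z \<and> e = \<alpha> \<or> s = -1 \<and> e = 1" for s e
    unfolding affine_germ_orbit[OF that]
    by (intro convergentI[of _ "e * (\<beta> + \<gamma> * of_real 0)"] tendsto_intros power_tendsto_0)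
  then show "convergent (\<lambda>k. affine_germ \<alpha> \<beta> \<gamma> (z * q ^ k))" "convergent (\<lambda>k. affine_germ \<alpha> \<beta> \<gamma> (- 1 * q ^ k))"
    by blast+
  have "{x \<in> Iq. z < x \<and> affine_germ \<alpha> \<beta> \<gamma> x \<noteq> 0} = {}" by (auto simp: affine_germ_def)
  then show "finite {x \<in> Iq. z < x \<and> affine_germ \<alpha> \<beta> \<gamma> x \<noteq> 0}" by (simp only: finite.emptyI)
qed (auto simp: affine_germ_def)

lemma L_affine_germ_H: "Lq (affine_germ \<alpha> \<beta> \<gamma>) \<in> Hq"
proof (rule mem_H_if_convergent[OF L_off_I])
  \<comment> \<open>Beyond \<open>z\<close> the cut-off only leaves the contribution of the neighbour \<open>q x = z\<close>.\<close>
  have "x = z * q powi (-1)" if x: "x \<in> Iq" "x > z" and nz: "Lq (affine_germ \<alpha> \<beta> \<gamma>) x \<noteq> 0" for x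
  proof -
    have "x \<le> x / q" using x z q by (simp add: field_simps mult_left_le)
    then have "affine_germ \<alpha> \<beta> \<gamma> x = 0" "affine_germ \<alpha> \<beta> \<gamma> (x / q) = 0"
      using x by (auto simp: affine_germ_def)
    then have "affine_germ \<alpha> \<beta> \<gamma> (q * x) \<noteq> 0"
      using nz by (auto simp: L_eq[OF x(1)])
    then have qx: "q * x \<le> z" by (auto simp: affine_germ_def split: if_splits)
    from x(1) show ?thesis
    proof (cases rule: I_cases)
      case (neg k)
      have "- (q ^ k) < 0" using q by simp
      then show ?thesis using x(2) z neg by linarith
    next
      case (pos k)
      have "k < 0"
      proof (rule ccontr)
        assume "\<not> k < 0"
        then have "q powi k \<le> 1" using q by (simp add: power_int_def power_le_one)
        then show False using x(2) z pos by (simp add: mult_left_le)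
      qed
      moreover have "k \<ge> -1"
      proof (rule ccontr)
        assume "\<not> k \<ge> -1"
        then have "q powi (k + 1) > 1"
          using power_int_strict_decreasing[of "k + 1" 0 q] q by simp
        moreover have "q * x = z * q powi (k + 1)" using pos q by (simp add: power_int_add)
        ultimately show False using qx z by simp
      qed
      ultimately have "k = -1" by simp
      then show ?thesis using pos by simp
    qed
  qed
  then have "{x \<in> Iq. z < x \<and> Lq (affine_germ \<alpha> \<beta> \<gamma>) x \<noteq> 0} \<subseteq> {z * q powi (-1)}" by blast
  then show "finite {x \<in> Iq. z < x \<and> Lq (affine_germ \<alpha> \<beta> \<gamma>) x \<noteq> 0}" by (rule finite_subset) simp
  show "convergent (\<lambda>k. Lq (affine_germ \<alpha> \<beta> \<gamma>) (z * q ^ k))"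
    "convergent (\<lambda>k. Lq (affine_germ \<alpha> \<beta> \<gamma>) (- 1 * q ^ k))"
    using L_affine_germ_orbit by blast+
qed

lemma affine_germ_tendsto:
  assumes e: "s = z \<and> e = \<alpha> \<or> s = -1 \<and> e = 1"
  shows "(\<lambda>k. affine_germ \<alpha> \<beta> \<gamma> (s * q ^ k)) \<longlonglongrightarrow> e * \<beta>"
    and "(\<lambda>k. Dq q (affine_germ \<alpha> \<beta> \<gamma>) (s * q ^ k)) \<longlonglongrightarrow> e * \<gamma>"
proof -
  have "(\<lambda>k. e * (\<beta> + \<gamma> * of_real (s * q ^ k))) \<longlonglongrightarrow> e * (\<beta> + \<gamma> * of_real 0)"
    by (intro tendsto_intros power_tendsto_0)
  then show "(\<lambda>k. affine_germ \<alpha> \<beta> \<gamma> (s * q ^ k)) \<longlonglongrightarrow> e * \<beta>"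
    unfolding affine_germ_orbit[OF e] by simp
  have "Dq q (affine_germ \<alpha> \<beta> \<gamma>) (s * q ^ k) = e * \<gamma>" for k
  proof -
    define x v where "x = s * q ^ k" and "v = (1 - q) * x"
    have "x \<noteq> 0" using e q z by (auto simp: x_def)
    then have v0: "v \<noteq> 0" using q by (simp add: v_def)
    have "affine_germ \<alpha> \<beta> \<gamma> (q * x) = e * (\<beta> + \<gamma> * of_real (q * x))"
      using affine_germ_orbit[OF e, of \<beta> \<gamma> "Suc k"] by (simp add: x_def mult_ac)
    moreover have "affine_germ \<alpha> \<beta> \<gamma> x = e * (\<beta> + \<gamma> * of_real x)"
      unfolding x_def by (rule affine_germ_orbit[OF e])
    ultimately have "affine_germ \<alpha> \<beta> \<gamma> x - affine_germ \<alpha> \<beta> \<gamma> (q * x) = e * \<gamma> * of_real v"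
      by (simp add: v_def algebra_simps)
    then show ?thesis unfolding Dq_def x_def[symmetric] v_def[symmetric] using v0 by simp
  qed
  then show "(\<lambda>k. Dq q (affine_germ \<alpha> \<beta> \<gamma>) (s * q ^ k)) \<longlonglongrightarrow> e * \<gamma>" by simp
qed

lemma affine_germ_D: "affine_germ \<alpha> \<beta> \<gamma> \<in> D q z a b c \<alpha>"
proof -
  have "(\<lambda>k::nat. affine_germ \<alpha> \<beta> \<gamma> (z * q ^ k)) \<longlonglongrightarrow> \<alpha> * \<beta> \<and>
        (\<lambda>k::nat. affine_germ \<alpha> \<beta> \<gamma> (- (q ^ k))) \<longlonglongrightarrow> \<beta> \<and>
        (\<lambda>k::nat. Dq q (affine_germ \<alpha> \<beta> \<gamma>) (z * q ^ k)) \<longlonglongrightarrow> \<alpha> * \<gamma> \<and>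
        (\<lambda>k::nat. Dq q (affine_germ \<alpha> \<beta> \<gamma>) (- (q ^ k))) \<longlonglongrightarrow> \<gamma>"
    using affine_germ_tendsto[of z \<alpha> \<alpha> \<beta> \<gamma>] affine_germ_tendsto[of "-1" 1 \<alpha> \<beta> \<gamma>] by simp
  then show ?thesis
    unfolding D_def using affine_germ_H L_affine_germ_H by blast
qed

section \<open>Self-adjointness\<close>

text \<open>
  On the domain the boundary values are \<open>e0, e1\<close> at \<open>0-\<close> and \<open>\<alpha> e0, \<alpha> e1\<close> at \<open>0+\<close>.
\<close>

lemma D_boundary_values:
  assumes "f \<in> D q z a b c \<alpha>"
  obtains e0 e1 where
    "(\<lambda>k. f (z * q ^ k)) \<longlonglongrightarrow> \<alpha> * e0" "(\<lambda>k. Dq q f (z * q ^ k)) \<longlonglongrightarrow> \<alpha> * e1"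
    "(\<lambda>k. f (- 1 * q ^ k)) \<longlonglongrightarrow> e0" "(\<lambda>k. Dq q f (- 1 * q ^ k)) \<longlonglongrightarrow> e1"
  using assms unfolding D_def by auto

lemma D_I:
  assumes "f \<in> Hq" "Lq f \<in> Hq"
    "(\<lambda>k. f (z * q ^ k)) \<longlonglongrightarrow> \<alpha> * e0" "(\<lambda>k. Dq q f (z * q ^ k)) \<longlonglongrightarrow> \<alpha> * e1"
    "(\<lambda>k. f (- 1 * q ^ k)) \<longlonglongrightarrow> e0" "(\<lambda>k. Dq q f (- 1 * q ^ k)) \<longlonglongrightarrow> e1"
  shows "f \<in> D q z a b c \<alpha>"
  using assms unfolding D_def by auto

lemma D_H: "f \<in> D q z a b c \<alpha> \<Longrightarrow> f \<in> Hq" "f \<in> D q z a b c \<alpha> \<Longrightarrow> Lq f \<in> Hq"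
  by (auto simp: D_def)

lemma L_add: "Lq (\<lambda>x. f x + g x) = (\<lambda>x. Lq f x + Lq g x)"
  by (auto simp: L_def fun_eq_iff algebra_simps)

lemma L_scale: "Lq (\<lambda>x. s * f x) = (\<lambda>x. s * Lq f x)"
  by (auto simp: L_def fun_eq_iff algebra_simps)

lemma Dq_add: "Dq q (\<lambda>x. f x + g x) x = Dq q f x + Dq q g x"
  by (simp add: Dq_def add_divide_distrib[symmetric] algebra_simps)

lemma Dq_scale: "Dq q (\<lambda>x. s * f x) x = s * Dq q f x"
  by (simp add: Dq_def right_diff_distrib)

lemma D_add:
  assumes f: "f \<in> D q z a b c \<alpha>" and g: "g \<in> D q z a b c \<alpha>"
  shows "(\<lambda>x. f x + g x) \<in> D q z a b c \<alpha>"
proof -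
  obtain e0 e1 where e: "(\<lambda>k. f (z * q ^ k)) \<longlonglongrightarrow> \<alpha> * e0" "(\<lambda>k. Dq q f (z * q ^ k)) \<longlonglongrightarrow> \<alpha> * e1"
    "(\<lambda>k. f (- 1 * q ^ k)) \<longlonglongrightarrow> e0" "(\<lambda>k. Dq q f (- 1 * q ^ k)) \<longlonglongrightarrow> e1"
    using f by (rule D_boundary_values)
  obtain h0 h1 where h: "(\<lambda>k. g (z * q ^ k)) \<longlonglongrightarrow> \<alpha> * h0" "(\<lambda>k. Dq q g (z * q ^ k)) \<longlonglongrightarrow> \<alpha> * h1"
    "(\<lambda>k. g (- 1 * q ^ k)) \<longlonglongrightarrow> h0" "(\<lambda>k. Dq q g (- 1 * q ^ k)) \<longlonglongrightarrow> h1"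
    using g by (rule D_boundary_values)
  show ?thesis
  proof (rule D_I[where ?e0.0 = "e0 + h0" and ?e1.0 = "e1 + h1"], goal_cases)
    case 2
    show ?case unfolding L_add by (intro H_add D_H(2)[OF f] D_H(2)[OF g])
  qed (use e h in \<open>auto simp: Dq_add distrib_left intro!: tendsto_add H_add D_H[OF f] D_H[OF g]\<close>)
qed

lemma D_scale:
  assumes f: "f \<in> D q z a b c \<alpha>"
  shows "(\<lambda>x. s * f x) \<in> D q z a b c \<alpha>"
proof -
  obtain e0 e1 where e: "(\<lambda>k. f (z * q ^ k)) \<longlonglongrightarrow> \<alpha> * e0" "(\<lambda>k. Dq q f (z * q ^ k)) \<longlonglongrightarrow> \<alpha> * e1"
    "(\<lambda>k. f (- 1 * q ^ k)) \<longlonglongrightarrow> e0" "(\<lambda>k. Dq q f (- 1 * q ^ k)) \<longlonglongrightarrow> e1"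
    using f by (rule D_boundary_values)
  show ?thesis
  proof (rule D_I[where ?e0.0 = "s * e0" and ?e1.0 = "s * e1"], goal_cases)
    case 2
    show ?case unfolding L_scale by (intro H_scale D_H(2)[OF f])
  qed (use e in \<open>auto simp: Dq_scale mult.left_commute[of \<alpha>] intro!: tendsto_mult_left H_scale D_H[OF f]\<close>)
qed

lemma linear_operator_D: "linear_operator_on Hq Lq (D q z a b c \<alpha>)"
  unfolding linear_operator_on_def linear_subspace_def
proof (intro conjI)
  show "(\<lambda>x. 0) \<in> D q z a b c \<alpha>" by (rule finite_support_D) auto
qed (auto simp: L_add L_scale D_H intro!: D_add D_scale)

lemma L_symmetric:
  assumes \<alpha>: "cmod \<alpha> = 1" and f: "f \<in> D q z a b c \<alpha>" and g: "g \<in> D q z a b c \<alpha>"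
  shows "ip (Lq f) g = ip f (Lq g)"
proof -
  obtain e0 e1 where e: "(\<lambda>k. f (z * q ^ k)) \<longlonglongrightarrow> \<alpha> * e0" "(\<lambda>k. Dq q f (z * q ^ k)) \<longlonglongrightarrow> \<alpha> * e1"
    "(\<lambda>k. f (- 1 * q ^ k)) \<longlonglongrightarrow> e0" "(\<lambda>k. Dq q f (- 1 * q ^ k)) \<longlonglongrightarrow> e1"
    using f by (rule D_boundary_values)
  obtain h0 h1 where h: "(\<lambda>k. g (z * q ^ k)) \<longlonglongrightarrow> \<alpha> * h0" "(\<lambda>k. Dq q g (z * q ^ k)) \<longlonglongrightarrow> \<alpha> * h1"
    "(\<lambda>k. g (- 1 * q ^ k)) \<longlonglongrightarrow> h0" "(\<lambda>k. Dq q g (- 1 * q ^ k)) \<longlonglongrightarrow> h1"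
    using g by (rule D_boundary_values)
  have "\<alpha> * cnj \<alpha> = 1" using \<alpha> complex_norm_square[of \<alpha>] by simp
  then have *: "\<alpha> * r * cnj (\<alpha> * t) = r * cnj t" for r t
    by (metis complex_cnj_mult mult.assoc mult.left_commute mult_1)
  have "ip (Lq f) g - ip f (Lq g) = of_real kappa *
      ((\<alpha> * e0 * cnj (\<alpha> * h1) - \<alpha> * e1 * cnj (\<alpha> * h0)) - (e0 * cnj h1 - e1 * cnj h0))"
    by (rule inner_green[OF D_H[OF f] D_H[OF g] e(1,2) h(1,2) e(3,4) h(3,4)])
  then show ?thesis unfolding * by simp
qed

lemma adjoint_domain_subset:
  assumes \<alpha>: "cmod \<alpha> = 1"
  shows "adjoint_domain Hq ip Lq (D q z a b c \<alpha>) \<subseteq> D q z a b c \<alpha>"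
proof
  fix g assume "g \<in> adjoint_domain Hq ip Lq (D q z a b c \<alpha>)"
  then obtain h where g: "g \<in> Hq" and h: "h \<in> Hq"
    and adj: "\<And>f. f \<in> D q z a b c \<alpha> \<Longrightarrow> ip (Lq f) g = ip f h"
    unfolding adjoint_domain_def by blast
  have hL: "h = Lq g" by (rule adjoint_value[OF g h adj])
  then have Lg: "Lq g \<in> Hq" using h by simp
  obtain g0 g1 where gz: "(\<lambda>k. g (z * q ^ k)) \<longlonglongrightarrow> g0" "(\<lambda>k. Dq q g (z * q ^ k)) \<longlonglongrightarrow> g1"
    using boundary_values_exist[OF z_in_I g Lg] .
  obtain h0 h1 where gn: "(\<lambda>k. g (- 1 * q ^ k)) \<longlonglongrightarrow> h0" "(\<lambda>k. Dq q g (- 1 * q ^ k)) \<longlonglongrightarrow> h1"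
    using boundary_values_exist[OF minus_one_in_I g Lg] .
  \<comment> \<open>The boundary term in Green's formula vanishes for all prescribed boundary values \<open>\<beta>, \<gamma>\<close>.\<close>
  have bv: "\<alpha> * \<beta> * cnj g1 - \<alpha> * \<gamma> * cnj g0 = \<beta> * cnj h1 - \<gamma> * cnj h0" for \<beta> \<gamma>
  proof -
    let ?f = "affine_germ \<alpha> \<beta> \<gamma>"
    have "ip (Lq ?f) g - ip ?f (Lq g) = of_real kappa *
        ((\<alpha> * \<beta> * cnj g1 - \<alpha> * \<gamma> * cnj g0) - (1 * \<beta> * cnj h1 - 1 * \<gamma> * cnj h0))"
      by (rule inner_green[OF affine_germ_H L_affine_germ_H g Lg _ _ gz _ _ gn];
          rule affine_germ_tendsto) auto
    moreover have "ip (Lq ?f) g = ip ?f (Lq g)" using adj[OF affine_germ_D] hL by simp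
    ultimately show ?thesis using kappa_pos by simp
  qed
  have "\<alpha> * cnj \<alpha> = 1" using \<alpha> complex_norm_square[of \<alpha>] by simp
  then have *: "r = \<alpha> * t" if "\<alpha> * cnj r = cnj t" for r t
    using arg_cong[OF that, of cnj] by (simp add: mult.assoc[symmetric]) (metis mult.assoc mult_1)
  have "g0 = \<alpha> * h0" "g1 = \<alpha> * h1"
    using bv[of 0 1] bv[of 1 0] by (auto intro!: *)
  then show "g \<in> D q z a b c \<alpha>" using gz gn by (auto intro: D_I[OF g Lg])
qed

lemma self_adjoint_D:
  assumes \<alpha>: "cmod \<alpha> = 1"
  shows "self_adjoint Hq ip Lq (D q z a b c \<alpha>)"
proof -
  have "D q z a b c \<alpha> \<subseteq> adjoint_domain Hq ip Lq (D q z a b c \<alpha>)"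
    using L_symmetric[OF \<alpha>] D_H unfolding adjoint_domain_def by blast
  moreover have "adjoint_op Hq ip Lq (D q z a b c \<alpha>) g = Lq g" if g: "g \<in> D q z a b c \<alpha>" for g
    unfolding adjoint_op_def
  proof (rule the_equality)
    show "Lq g \<in> Hq \<and> (\<forall>f\<in>D q z a b c \<alpha>. ip (Lq f) g = ip f (Lq g))"
      using L_symmetric[OF \<alpha> _ g] D_H(2)[OF g] by blast
    show "h = Lq g" if "h \<in> Hq \<and> (\<forall>f\<in>D q z a b c \<alpha>. ip (Lq f) g = ip f h)" for h
      using that by (intro adjoint_value[OF D_H(1)[OF g]]) auto
  qed
  ultimately show ?thesis
    unfolding self_adjoint_def
    using linear_operator_D dense_D adjoint_domain_subset[OF \<alpha>] by blast
qed

end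

theorem proposition2p7:
  fixes q z a b c :: real and \<alpha> :: complex
  assumes "0 < q" and "q < 1" and "z > 0" and "(a, b, c) \<in> V" and "cmod \<alpha> = 1"
  shows "self_adjoint (H q z a b c) (inner_H q z a b c) (L q z a b c) (D q z a b c \<alpha>)"
proof -
  interpret q_lattice q z a b c
    using assms by unfold_locales (auto simp: V_def)
  show ?thesis using assms by (intro self_adjoint_D)
qed

end
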